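(* Let $r \geq 1$. Every connected non-negative unit form $q:\mathbb{Z}^n\to\mathbb{Z}$ of Dynkin type $\mathbb{A}_r$ is strongly Gram congruent to a unique standard extension of the unit form $q_{\mathbb{A}_r}$, i.e. to $q_{\vec{\mathbb{A}}^{\mathrm{d}}_{r+1}[\pi]}$ for a unique pair $(\pi,\mathrm{d})$ with $\pi$ a partition of $r+1$ and $\mathrm{d}\ge 0$ an integer.
   Context: An integral quadratic form $q:\mathbb{Z}^n\to\mathbb{Z}$, $q(x)=\sum_{i\le j}q_{ij}x_ix_j$, is a unit form if $q(\mathbf{e}_i)=1$ for all $i$; it is non-negative if $q(x)\ge 0$ for all $x$; it is connected if the graph on $\{1,\dots,n\}$ with an edge $i$–$j$ whenever $q_{ij}\neq 0$ ($i<j$) is connected. $G_q$ denotes the symmetric Gram matrix of the polarization $\mathbb{b}_q(x,y)=q(x+y)-q(x)-q(y)$, and $\check{G}_q$ the unique upper triangular integer matrix with $q(x)=x^{\mathrm{tr}}\check{G}_qx$ (so $G_q=\check{G}_q+\check{G}_q^{\mathrm{tr}}$, and $\check G_q$ has ones on the diagonal for a unit form). Two unit forms $q,q'$ in $n$ variables are weakly Gram congruent if $G_{q'}=B^{\mathrm{tr}}G_qB$ for some $\mathbb{Z}$-invertible $B$, and strongly Gram congruent if $\check{G}_{q'}=B^{\mathrm{tr}}\check{G}_qB$ for some $\mathbb{Z}$-invertible $B$. The Dynkin type of a connected non-negative unit form $q$ is the unique simply-laced Dynkin diagram $\Delta$ such that the form induced by $q$ on $\mathbb{Z}^n/\mathrm{rad}(q)$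 (where $\mathrm{rad}(q)=\ker G_q$) is equivalent to $q_\Delta$, the form with $G_{q_\Delta}=2\mathrm{Id}-\mathrm{Adj}(\Delta)$. Quivers: a quiver $Q$ has vertices $\{1,\dots,m\}$, arrows $\{1,\dots,n\}$ and source/target maps $s,t$. Its incidence matrix $I(Q)$ is the $m\times n$ matrix whose $i$-th column is $\mathbf{e}_{s(i)}-\mathbf{e}_{t(i)}$, and $q_Q(x)=\frac12\|I(Q)x\|^2$. Standard quivers: let $m\ge 2$, $\pi=(\pi_1\ge\dots\ge\pi_\ell>0)$ a partition of $m$, $\mathrm{d}\ge0$, and $v_t=m-(\pi_1+\dots+\pi_t)$ for $t=0,\dots,\ell$. The quiver $\vec{\mathbb{A}}^{\mathrm{d}}_m[\pi]$ has vertices $1,\dots,m$ and $n=m+\ell+2(\mathrm{d}-1)$ arrows, ordered $i_1<\dots<i_{m-1}<j_1<\dots<j_{\ell-1}<k_1<\dots<k_{2\mathrm{d}}$ (numbered $1,\dots,n$ in this order), where $s(i_t)=t$, $t(i_t)=t+1$; $s(j_t)=v_{t-1}$, $t(j_t)=v_t$ ($1\le t\le \ell-1$); and, with $\alpha=i_{m-1}$ if $\ell=1$ and $\alpha=j_{\ell-1}$ if $\ell>1$, the arrow $k_t$ goes from $s(\alpha)$ to $t(\alpha)$ when $t$ is even and from $t(\alpha)$ to $s(\alpha)$ when $t$ is odd. The form $q_{\vec{\mathbb{A}}^{\mathrm{d}}_m[\pi]}$ is called the standard $(\pi,\mathrm{d})$-extension of $q_{\mathbb{A}_{m-1}}$.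 *)

theory Defs
  imports "Jordan_Normal_Form.Matrix_Kernel" "HOL-Algebra.Coset"
begin

text \<open>
  A form in \<open>n\<close> variables is a function on integer vectors of which only the values on
  \<open>carrier_vec n\<close> matter. Vector and matrix indices start at 0, whereas the vertices and arrows
  of quivers are numbered from 1.
\<close>

section \<open>Integral quadratic forms\<close>

definition integral_quadratic_form :: "nat \<Rightarrow> (int vec \<Rightarrow> int) \<Rightarrow> bool" where
  "integral_quadratic_form n q \<longleftrightarrow>
     (\<exists>c :: nat \<Rightarrow> nat \<Rightarrow> int. \<forall>x \<in> carrier_vec n.
        q x = (\<Sum>j<n. \<Sum>i\<le>j. c i j * x $ i * x $ j))"

definition unit_form :: "nat \<Rightarrow> (int vec \<Rightarrow> int) \<Rightarrow> bool" where
  "unit_form n q \<longleftrightarrow> integral_quadratic_form n q \<and> (\<forall>i<n. q (unit_vec n i) = 1)"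

definition nonneg_form :: "nat \<Rightarrow> (int vec \<Rightarrow> int) \<Rightarrow> bool" where
  "nonneg_form n q \<longleftrightarrow> (\<forall>x \<in> carrier_vec n. q x \<ge> 0)"

definition polarization :: "(int vec \<Rightarrow> int) \<Rightarrow> int vec \<Rightarrow> int vec \<Rightarrow> int" where
  "polarization q x y = q (x + y) - q x - q y"

definition gram :: "nat \<Rightarrow> (int vec \<Rightarrow> int) \<Rightarrow> int mat" where
  "gram n q = mat n n (\<lambda>(i, j). polarization q (unit_vec n i) (unit_vec n j))"

definition upper_gram :: "nat \<Rightarrow> (int vec \<Rightarrow> int) \<Rightarrow> int mat" where
  "upper_gram n q = (THE M. M \<in> carrier_mat n n \<and> upper_triangular M \<and>
     (\<forall>x \<in> carrier_vec n. q x = x \<bullet> (M *\<^sub>v x)))"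

lemma scalar_prod_mult_mat_vec:
  fixes M :: "int mat"
  assumes "M \<in> carrier_mat n n" and "x \<in> carrier_vec n"
  shows "x \<bullet> (M *\<^sub>v x) = (\<Sum>i<n. \<Sum>j<n. M $$ (i, j) * x $ i * x $ j)"
  using assms
  by (auto simp: scalar_prod_def row_def sum_distrib_left lessThan_atLeast0 intro!: sum.cong)

lemma matrix_form_polarization:
  fixes M :: "int mat"
  assumes M: "M \<in> carrier_mat n n" and q: "\<forall>x \<in> carrier_vec n. q x = x \<bullet> (M *\<^sub>v x)"
    and ij: "i < n" "j < n"
  shows "q (unit_vec n i) = M $$ (i, i)"
    and "polarization q (unit_vec n i) (unit_vec n j) = M $$ (i, j) + M $$ (j, i)"
proof -
  have u: "unit_vec n a \<bullet> (M *\<^sub>v unit_vec n b) = M $$ (a, b)" if "a < n" "b < n" for a b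
    using M that by simp
  show "q (unit_vec n i) = M $$ (i, i)"
    using q ij u by simp
  have "q (unit_vec n i + unit_vec n j) =
      M $$ (i, i) + M $$ (i, j) + (M $$ (j, i) + M $$ (j, j))"
    using q ij u M
    by (simp add: mult_add_distrib_mat_vec[OF M] add_scalar_prod_distrib[of _ n]
        scalar_prod_add_distrib[of _ n] del: scalar_prod_left_unit)
  then show "polarization q (unit_vec n i) (unit_vec n j) = M $$ (i, j) + M $$ (j, i)"
    using q ij u by (simp add: polarization_def)
qed

lemma ex1_upper_gram:
  assumes "integral_quadratic_form n q"
  shows "\<exists>!M. M \<in> carrier_mat n n \<and> upper_triangular M \<and>
     (\<forall>x \<in> carrier_vec n. q x = x \<bullet> (M *\<^sub>v x))"
proof (rule ex_ex1I)
  obtain c :: "nat \<Rightarrow> nat \<Rightarrow> int" where c: "\<And>x. x \<in> carrier_vec n \<Longrightarrow>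
      q x = (\<Sum>j<n. \<Sum>i\<le>j. c i j * x $ i * x $ j)"
    using assms unfolding integral_quadratic_form_def by blast
  define M where "M = mat n n (\<lambda>(i, j). if i \<le> j then c i j else 0)"
  have M: "M \<in> carrier_mat n n" "upper_triangular M"
    by (auto simp: M_def)
  have "q x = x \<bullet> (M *\<^sub>v x)" if x: "x \<in> carrier_vec n" for x
  proof -
    have "x \<bullet> (M *\<^sub>v x) = (\<Sum>j<n. \<Sum>i<n. M $$ (i, j) * x $ i * x $ j)"
      by (subst sum.swap) (rule scalar_prod_mult_mat_vec[OF M(1) x])
    also have "\<dots> = (\<Sum>j<n. \<Sum>i\<le>j. c i j * x $ i * x $ j)"
    proof (rule sum.cong[OF refl])
      fix j assume "j \<in> {..<n}"
      then show "(\<Sum>i<n. M $$ (i, j) * x $ i * x $ j) = (\<Sum>i\<le>j. c i j * x $ i * x $ j)"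
        by (intro sum.mono_neutral_cong_right) (auto simp: M_def)
    qed
    finally show ?thesis using c[OF x] by simp
  qed
  with M show "\<exists>M. M \<in> carrier_mat n n \<and> upper_triangular M \<and>
     (\<forall>x \<in> carrier_vec n. q x = x \<bullet> (M *\<^sub>v x))" by blast
next
  fix M N
  assume M: "M \<in> carrier_mat n n \<and> upper_triangular M \<and>
      (\<forall>x \<in> carrier_vec n. q x = x \<bullet> (M *\<^sub>v x))"
    and N: "N \<in> carrier_mat n n \<and> upper_triangular N \<and>
      (\<forall>x \<in> carrier_vec n. q x = x \<bullet> (N *\<^sub>v x))"
  show "M = N"
  proof (rule eq_matI)
    fix i j assume "i < dim_row N" "j < dim_col N"
    then have ij: "i < n" "j < n" using N by auto
    have "M $$ (i, j) + M $$ (j, i) = N $$ (i, j) + N $$ (j, i)"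
      using matrix_form_polarization(2)[of M n q i j]
        matrix_form_polarization(2)[of N n q i j] M N ij by simp
    moreover have "X $$ (i, j) = 0 \<or> X $$ (j, i) = 0 \<or> i = j"
      if "X \<in> carrier_mat n n" "upper_triangular X" for X :: "int mat"
      using that ij unfolding upper_triangular_def by (metis carrier_matD(1) linorder_neqE_nat)
    ultimately show "M $$ (i, j) = N $$ (i, j)"
      using M N ij unfolding upper_triangular_def
      by (cases i j rule: linorder_cases) auto
  qed (use M N in auto)
qed

text \<open>For \<open>i < j\<close> the coefficient \<open>q\<^sub>i\<^sub>j\<close> of the form is the entry \<open>(i, j)\<close> of \<open>upper_gram n q\<close>.\<close>

definition connected_form :: "nat \<Rightarrow> (int vec \<Rightarrow> int) \<Rightarrow> bool" where
  "connected_form n q \<longleftrightarrow>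
     (let E = {(i, j). i < j \<and> j < n \<and> upper_gram n q $$ (i, j) \<noteq> 0}
      in \<forall>i<n. \<forall>j<n. (i, j) \<in> (E \<union> E\<inverse>)\<^sup>*)"

definition strongly_gram_congruent ::
    "nat \<Rightarrow> (int vec \<Rightarrow> int) \<Rightarrow> (int vec \<Rightarrow> int) \<Rightarrow> bool" where
  "strongly_gram_congruent n q q' \<longleftrightarrow>
     (\<exists>B \<in> carrier_mat n n. invertible_mat B \<and>
        upper_gram n q' = transpose_mat B * upper_gram n q * B)"


section \<open>Dynkin type\<close>

datatype dynkin = Dynkin_A nat | Dynkin_D nat | Dynkin_E nat

fun dynkin_diagram :: "dynkin \<Rightarrow> bool" where
  "dynkin_diagram (Dynkin_A r) \<longleftrightarrow> r \<ge> 1"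
| "dynkin_diagram (Dynkin_D r) \<longleftrightarrow> r \<ge> 4"
| "dynkin_diagram (Dynkin_E r) \<longleftrightarrow> r \<in> {6, 7, 8}"

fun dynkin_rank :: "dynkin \<Rightarrow> nat" where
  "dynkin_rank (Dynkin_A r) = r"
| "dynkin_rank (Dynkin_D r) = r"
| "dynkin_rank (Dynkin_E r) = r"

text \<open>
  The edges \<open>i < j\<close> on the vertices \<open>{0..<r}\<close>. In types D and E the vertices other than \<open>r - 1\<close>
  form a path, and \<open>r - 1\<close> is attached to the branching vertex.
\<close>

fun dynkin_edge :: "dynkin \<Rightarrow> nat \<Rightarrow> nat \<Rightarrow> bool" where
  "dynkin_edge (Dynkin_A r) i j \<longleftrightarrow> j = i + 1"
| "dynkin_edge (Dynkin_D r) i j \<longleftrightarrow> (if j = r - 1 then i = r - 3 else j = i + 1)"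
| "dynkin_edge (Dynkin_E r) i j \<longleftrightarrow> (if j = r - 1 then i = 2 else j = i + 1)"

definition adjacency_mat :: "dynkin \<Rightarrow> int mat" where
  "adjacency_mat \<Delta> = mat (dynkin_rank \<Delta>) (dynkin_rank \<Delta>)
     (\<lambda>(i, j). if i < j \<and> dynkin_edge \<Delta> i j \<or> j < i \<and> dynkin_edge \<Delta> j i then 1 else 0)"

definition dynkin_form :: "dynkin \<Rightarrow> int vec \<Rightarrow> int" where
  "dynkin_form \<Delta> x = (x \<bullet> ((2 \<cdot>\<^sub>m 1\<^sub>m (dynkin_rank \<Delta>) - adjacency_mat \<Delta>) *\<^sub>v x)) div 2"

lemma dynkin_form_double:
  assumes x: "x \<in> carrier_vec (dynkin_rank \<Delta>)"
  shows "2 * dynkin_form \<Delta> x =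
    x \<bullet> ((2 \<cdot>\<^sub>m 1\<^sub>m (dynkin_rank \<Delta>) - adjacency_mat \<Delta>) *\<^sub>v x)"
proof -
  let ?n = "dynkin_rank \<Delta>"
  let ?M = "2 \<cdot>\<^sub>m 1\<^sub>m ?n - adjacency_mat \<Delta>"
  let ?f = "\<lambda>i j. ?M $$ (i, j) * x $ i * x $ j"
  have M: "?M \<in> carrier_mat ?n ?n" by (auto simp: adjacency_mat_def)
  have sym: "?f i j = ?f j i" if "i < ?n" "j < ?n" for i j
    using that by (auto simp: adjacency_mat_def)
  have diag: "even (?f i i)" if "i < ?n" for i
    using that by (auto simp: adjacency_mat_def)
  have "even (\<Sum>i<k. \<Sum>j<k. ?f i j)" if "k \<le> ?n" for k
    using that
  proof (induction k)
    case (Suc k)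
    have "(\<Sum>i<k. ?f i k) = (\<Sum>j<k. ?f k j)"
      using Suc.prems by (intro sum.cong refl sym) auto
    moreover have "(\<Sum>i<Suc k. \<Sum>j<Suc k. ?f i j) =
        (\<Sum>i<k. \<Sum>j<k. ?f i j) + (\<Sum>i<k. ?f i k) + (\<Sum>j<k. ?f k j) + ?f k k"
      by (simp only: sum.lessThan_Suc sum.distrib add.assoc)
    ultimately show ?case using Suc diag[of k] by simp
  qed simp
  from this[OF order_refl] show ?thesis
    using scalar_prod_mult_mat_vec[OF M x] by (simp add: dynkin_form_def)
qed

definition rad :: "nat \<Rightarrow> (int vec \<Rightarrow> int) \<Rightarrow> int vec set" where
  "rad n q = mat_kernel (gram n q)"

text \<open>The form induced on \<open>\<int>\<^sup>n / rad q\<close>: \<open>q\<close> is constant on each coset \<open>C\<close>.\<close>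

definition induced_form :: "(int vec \<Rightarrow> int) \<Rightarrow> int vec set \<Rightarrow> int" where
  "induced_form q C = the_elem (q ` C)"

definition has_dynkin_type :: "nat \<Rightarrow> (int vec \<Rightarrow> int) \<Rightarrow> dynkin \<Rightarrow> bool" where
  "has_dynkin_type n q \<Delta> \<longleftrightarrow> dynkin_diagram \<Delta> \<and>
     (\<exists>\<phi> \<in> iso (monoid_vec TYPE(int) (dynkin_rank \<Delta>)) (monoid_vec TYPE(int) n Mod rad n q).
        \<forall>y \<in> carrier_vec (dynkin_rank \<Delta>). induced_form q (\<phi> y) = dynkin_form \<Delta> y)"


section \<open>Quivers and standard extensions\<close>

record quiver =
  num_vertices :: nat
  num_arrows :: nat
  source :: "nat \<Rightarrow> nat"
  target :: "nat \<Rightarrow> nat"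

definition incidence_mat :: "quiver \<Rightarrow> int mat" where
  "incidence_mat Q = mat (num_vertices Q) (num_arrows Q)
     (\<lambda>(v, a). of_bool (source Q (a + 1) = v + 1) - of_bool (target Q (a + 1) = v + 1))"

definition quiver_form :: "quiver \<Rightarrow> int vec \<Rightarrow> int" where
  "quiver_form Q x = ((incidence_mat Q *\<^sub>v x) \<bullet> (incidence_mat Q *\<^sub>v x)) div 2"

lemma quiver_form_double:
  assumes x: "x \<in> carrier_vec (num_arrows Q)"
    and st: "\<And>a. a \<in> {1..num_arrows Q} \<Longrightarrow>
      source Q a \<in> {1..num_vertices Q} \<and> target Q a \<in> {1..num_vertices Q}"
  shows "2 * quiver_form Q x = (incidence_mat Q *\<^sub>v x) \<bullet> (incidence_mat Q *\<^sub>v x)"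
proof -
  let ?m = "num_vertices Q" and ?n = "num_arrows Q"
  let ?y = "incidence_mat Q *\<^sub>v x"
  have col: "(\<Sum>v<?m. incidence_mat Q $$ (v, a)) = 0" if "a < ?n" for a
  proof -
    have one: "(\<Sum>v<?m. of_bool (w = v + 1) :: int) = 1" if "w \<in> {1..?m}" for w
    proof -
      have "(\<Sum>v<?m. of_bool (w = v + 1) :: int) = (\<Sum>v<?m. if v = w - 1 then 1 else 0)"
        using that by (intro sum.cong) auto
      then show ?thesis using that by auto
    qed
    have "(\<Sum>v<?m. incidence_mat Q $$ (v, a)) =
        (\<Sum>v<?m. of_bool (source Q (a + 1) = v + 1) - of_bool (target Q (a + 1) = v + 1))"
      using that by (intro sum.cong) (auto simp: incidence_mat_def)
    also have "\<dots> = 0"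
      using st[of "a + 1"] one that unfolding sum_subtractf by simp
    finally show ?thesis .
  qed
  have y: "?y $ v = (\<Sum>a<?n. incidence_mat Q $$ (v, a) * x $ a)" if "v < ?m" for v
    using that x by (auto simp: incidence_mat_def scalar_prod_def lessThan_atLeast0 intro!: sum.cong)
  have "(\<Sum>v<?m. ?y $ v) = (\<Sum>a<?n. \<Sum>v<?m. incidence_mat Q $$ (v, a) * x $ a)"
    by (subst sum.swap) (simp add: y)
  also have "\<dots> = 0"
    by (simp add: col flip: sum_distrib_right)
  finally have "even (\<Sum>v<?m. ?y $ v)" by simp
  moreover have "even ((\<Sum>v<k. ?y $ v * ?y $ v) + (\<Sum>v<k. ?y $ v))" for k
    by (induction k) auto
  ultimately have "even (\<Sum>v<?m. ?y $ v * ?y $ v)" by (metis even_add)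
  then show ?thesis
    by (simp add: quiver_form_def scalar_prod_def incidence_mat_def lessThan_atLeast0)
qed

definition partition_of :: "nat \<Rightarrow> nat list \<Rightarrow> bool" where
  "partition_of m \<pi> \<longleftrightarrow> sorted_wrt (\<ge>) \<pi> \<and> (\<forall>p \<in> set \<pi>. p > 0) \<and> sum_list \<pi> = m"

definition std_vertex :: "nat \<Rightarrow> nat list \<Rightarrow> nat \<Rightarrow> nat" where
  "std_vertex m \<pi> t = m - sum_list (take t \<pi>)"

text \<open>Source and target of the arrows \<open>i\<^sub>1, \<dots>, i\<^sub>m\<^sub>-\<^sub>1, j\<^sub>1, \<dots>, j\<^sub>l\<^sub>-\<^sub>1\<close>, numbered consecutively from 1.\<close>

definition std_base_arrow :: "nat \<Rightarrow> nat list \<Rightarrow> nat \<Rightarrow> nat \<times> nat" where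
  "std_base_arrow m \<pi> a =
     (if a \<le> m - 1 then (a, a + 1)
      else let t = a - (m - 1) in (std_vertex m \<pi> (t - 1), std_vertex m \<pi> t))"

definition std_arrow :: "nat \<Rightarrow> nat list \<Rightarrow> nat \<Rightarrow> nat \<times> nat" where
  "std_arrow m \<pi> a =
     (let l = length \<pi>; b = (m - 1) + (l - 1) in
      if a \<le> b then std_base_arrow m \<pi> a
      else let \<alpha> = (if l = 1 then m - 1 else b);
               (s, t) = std_base_arrow m \<pi> \<alpha>
           in if even (a - b) then (s, t) else (t, s))"

text \<open>The quiver has \<open>m + l + 2 (d - 1)\<close> arrows, written here without truncated subtraction of
  \<open>d - 1\<close>.\<close>

definition std_quiver :: "nat \<Rightarrow> nat list \<Rightarrow> nat \<Rightarrow> quiver" where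
  "std_quiver m \<pi> d =
     \<lparr> num_vertices = m,
       num_arrows = (m - 1) + (length \<pi> - 1) + 2 * d,
       source = (\<lambda>a. fst (std_arrow m \<pi> a)),
       target = (\<lambda>a. snd (std_arrow m \<pi> a)) \<rparr>"

end

theory Submission
  imports Defs "HOL-Combinatorics.Permutations" "Jordan_Normal_Form.Determinant"
begin

text \<open>
  A form of Dynkin type \<open>\<bbbA>\<^sub>r\<close> is the form of a connected loop-free quiver on \<open>r + 1\<close> vertices,
  because the vectors of norm 2 in the root lattice are the differences of two distinct unit
  vectors. For consecutive arrows \<open>u, w\<close> the replacement of \<open>(u, w)\<close> by \<open>(w, s\<^sub>w u)\<close>,
  where \<open>s\<^sub>w\<close> is the reflection at \<open>w\<close>, and the reversal of an arrow are strong Gram congruences,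
  so that the classification reduces to Hurwitz equivalence of transitive tuples of
  transpositions. By Hurwitz such tuples are equivalent if they have the same length and the same
  product. Up to relabelling the vertices, only the cycle type \<open>\<pi>\<close> of the product remains, and the
  genus in the Riemann-Hurwitz formula \<open>n + 2 = m + \<ell> + 2 d\<close> is the number \<open>d\<close>. Conversely, the
  trace of the \<open>k\<close>-th power of the Coxeter transformation is invariant and counts, up to \<open>n - m\<close>,
  the fixed points of the \<open>k\<close>-th power of the product, that is, it is the sum of the parts of \<open>\<pi>\<close>
  dividing \<open>k\<close>; these sums determine \<open>\<pi>\<close>.
\<close>


section \<open>Hurwitz equivalence of arrow sequences\<close>

text \<open>The reflection at \<open>e\<^sub>s - e\<^sub>t\<close> exchanges the coordinates
  \<open>s\<close> and \<open>t\<close>; hence a list of roots can be handled as a list of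
  transpositions, orientation being only the sign of a basis vector. A reflection alone would
  destroy the triangular shape of the upper Gram matrix; exchanging the two positions at the same
  time restores it, and this singles out the braid moves. The obstacle in Hurwitz's theorem is
  excess arrows, which the product does not see. A pair of equal arrows has trivial product, so it
  moves freely through the sequence, and connectedness of the rest lets its far end be chosen at
  will. With more than two vertices one vertex can thus be split off with one or two arrows, and the
  product decides which. For the converse, let \<open>Y\<close> be the incidence matrix and
  \<open>A\<close> the upper Gram matrix, so that \<open>A + A\<^sup>T = Y\<^sup>T Y\<close>. The
  Coxeter transformation \<open>1 - A\<inverse> Y\<^sup>T Y\<close> on arrows and the matrix
  \<open>1 - Y A\<inverse> Y\<^sup>T\<close> on vertices have powers with the same trace up to the
  difference of the sizes, and the second is the permutation matrix of the product.\<close>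

definition arrow_swap :: "'a \<times> 'a \<Rightarrow> 'a \<Rightarrow> 'a" where
  "arrow_swap w = Transposition.transpose (fst w) (snd w)"

text \<open>Acting on both ends by the swap is the reflection \<open>s\<^sub>w\<close> on the root
  \<open>e\<^sub>a - e\<^sub>b\<close>; orientation is carried along.\<close>

definition reflect_arrow :: "'a \<times> 'a \<Rightarrow> 'a \<times> 'a \<Rightarrow> 'a \<times> 'a" where
  "reflect_arrow w u = map_prod (arrow_swap w) (arrow_swap w) u"

text \<open>Symmetry is a rule, so inverse braid moves are included. Flips are separate moves
  because arrows carry an orientation that their transpositions forget.\<close>

inductive hurwitz_eq :: "('a \<times> 'a) list \<Rightarrow> ('a \<times> 'a) list \<Rightarrow> bool" (infix "\<approx>" 50) where
  hurwitz_refl: "xs \<approx> xs"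
| hurwitz_sym: "xs \<approx> ys \<Longrightarrow> ys \<approx> xs"
| hurwitz_trans [trans]: "xs \<approx> ys \<Longrightarrow> ys \<approx> zs \<Longrightarrow> xs \<approx> zs"
| hurwitz_flip: "xs @ (s, t) # ys \<approx> xs @ (t, s) # ys"
| hurwitz_braid: "xs @ u # w # ys \<approx> xs @ w # reflect_arrow w u # ys"

text \<open>The head acts first. With this order a braid move keeps the product: \<open>u\<close>
  then \<open>w\<close> equals \<open>w\<close> then the conjugate of \<open>u\<close> by
  \<open>w\<close>.\<close>

primrec monodromy :: "('a \<times> 'a) list \<Rightarrow> 'a \<Rightarrow> 'a" where
  "monodromy [] = id"
| "monodromy (w # xs) = monodromy xs \<circ> arrow_swap w"

definition arrows_on :: "'a set \<Rightarrow> ('a \<times> 'a) list \<Rightarrow> bool" where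
  "arrows_on V xs \<longleftrightarrow> (\<forall>(s, t) \<in> set xs. s \<in> V \<and> t \<in> V \<and> s \<noteq> t)"

definition saturated :: "('a \<times> 'a) list \<Rightarrow> 'a set \<Rightarrow> bool" where
  "saturated xs S \<longleftrightarrow> (\<forall>(s, t) \<in> set xs. s \<in> S \<longleftrightarrow> t \<in> S)"

text \<open>Connectedness of the graph on \<open>V\<close>, phrased through unions of components
  instead of paths: a Hurwitz move keeps every saturated set, whereas it may destroy a given
  path.\<close>

definition linked :: "'a set \<Rightarrow> ('a \<times> 'a) list \<Rightarrow> bool" where
  "linked V xs \<longleftrightarrow> (\<forall>S \<subseteq> V. S \<noteq> {} \<longrightarrow> saturated xs S \<longrightarrow> S = V)"

lemma arrow_swap_involution [simp]: "arrow_swap w (arrow_swap w x) = x"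
  by (simp add: arrow_swap_def)

lemma inj_arrow_swap: "inj (arrow_swap w)"
  by (simp add: arrow_swap_def inj_transpose)

lemma arrow_swap_flip: "arrow_swap (t, s) = arrow_swap (s, t)"
  by (simp add: arrow_swap_def transpose_commute)

lemma reflect_arrow_involution [simp]: "reflect_arrow w (reflect_arrow w u) = u"
  by (cases u) (simp add: reflect_arrow_def)

lemma arrow_swap_reflect: "arrow_swap (reflect_arrow w u) = arrow_swap w \<circ> arrow_swap u \<circ> arrow_swap w"
proof
  fix x
  have "(arrow_swap w x = y) = (x = arrow_swap w y)" for y by auto
  then show "arrow_swap (reflect_arrow w u) x = (arrow_swap w \<circ> arrow_swap u \<circ> arrow_swap w) x"
    by (cases u) (simp add: reflect_arrow_def arrow_swap_def[of u] arrow_swap_def[of "(_, _)"] Transposition.transpose_def)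
qed

lemma hurwitz_eq_context:
  assumes "xs \<approx> ys" shows "ps @ xs @ qs \<approx> ps @ ys @ qs"
  using assms
proof induction
  case (hurwitz_flip xs s t ys)
  then show ?case using hurwitz_eq.hurwitz_flip[of "ps @ xs" s t "ys @ qs"] by simp
next
  case (hurwitz_braid xs u w ys)
  then show ?case using hurwitz_eq.hurwitz_braid[of "ps @ xs" u w "ys @ qs"] by simp
qed (auto intro: hurwitz_eq.intros)

lemma hurwitz_eq_append:
  "xs \<approx> xs' \<Longrightarrow> ys \<approx> ys' \<Longrightarrow> xs @ ys \<approx> xs' @ ys'"
  using hurwitz_eq_context[of xs xs' "[]" ys] hurwitz_eq_context[of ys ys' xs' "[]"]
  by (auto intro: hurwitz_trans)

lemma hurwitz_eq_Cons: "xs \<approx> ys \<Longrightarrow> x # xs \<approx> x # ys"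
  using hurwitz_eq_context[of xs ys "[x]" "[]"] by simp

lemma hurwitz_eq_length: "xs \<approx> ys \<Longrightarrow> length xs = length ys"
  by (induction rule: hurwitz_eq.induct) auto

lemma monodromy_append: "monodromy (xs @ ys) = monodromy ys \<circ> monodromy xs"
  by (induction xs) (simp_all add: comp_assoc)

lemma hurwitz_eq_monodromy: "xs \<approx> ys \<Longrightarrow> monodromy xs = monodromy ys"
proof (induction rule: hurwitz_eq.induct)
  case (hurwitz_flip xs s t ys)
  then show ?case by (simp add: monodromy_append arrow_swap_flip)
next
  case (hurwitz_braid xs u w ys)
  then show ?case by (simp add: monodromy_append arrow_swap_reflect fun_eq_iff)
qed auto

lemma arrow_swap_mem_iff: "(fst w \<in> S \<longleftrightarrow> snd w \<in> S) \<Longrightarrow> arrow_swap w x \<in> S \<longleftrightarrow> x \<in> S"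
  by (simp add: arrow_swap_def Transposition.transpose_def)

text \<open>If both ends of \<open>w\<close> lie on the same side of \<open>S\<close>, its swap
  preserves \<open>S\<close>, so reflecting \<open>u\<close> at \<open>w\<close> does not move an
  end of \<open>u\<close> across the boundary of \<open>S\<close>.\<close>

lemma hurwitz_eq_saturated: "xs \<approx> ys \<Longrightarrow> saturated xs S \<longleftrightarrow> saturated ys S"
proof (induction rule: hurwitz_eq.induct)
  case (hurwitz_braid xs u w ys)
  then show ?case
    by (cases u; cases w) (auto simp: saturated_def reflect_arrow_def arrow_swap_mem_iff)
qed (auto simp: saturated_def)

lemma hurwitz_eq_linked: "xs \<approx> ys \<Longrightarrow> linked V xs \<longleftrightarrow> linked V ys"
  by (simp add: linked_def hurwitz_eq_saturated)

lemma hurwitz_eq_arrows_on: "xs \<approx> ys \<Longrightarrow> arrows_on V xs \<longleftrightarrow> arrows_on V ys"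
proof (induction rule: hurwitz_eq.induct)
  case (hurwitz_braid xs u w ys)
  then show ?case
    by (cases u; cases w) (auto simp: arrows_on_def reflect_arrow_def arrow_swap_mem_iff inj_eq[OF inj_arrow_swap])
qed (auto simp: arrows_on_def)

section \<open>Moving arrows and pairs of equal arrows through a sequence\<close>

lemma hurwitz_move_left: "u # w # ys \<approx> reflect_arrow u w # u # ys"
  using hurwitz_braid[of "[]" "reflect_arrow u w" u ys] by (simp add: hurwitz_sym)

lemma hurwitz_move_past: "x # ys @ zs \<approx> map (reflect_arrow x) ys @ x # zs"
proof (induction ys)
  case (Cons y ys)
  have "x # y # ys @ zs \<approx> reflect_arrow x y # x # ys @ zs"
    by (rule hurwitz_move_left)
  also have "\<dots> \<approx> reflect_arrow x y # map (reflect_arrow x) ys @ x # zs"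
    by (rule hurwitz_eq_Cons[OF Cons])
  finally show ?case by simp
qed (simp add: hurwitz_refl)

text \<open>The two copies of \<open>p\<close> pass \<open>zs\<close> one after the other, and the
  two reflections at \<open>p\<close> that this causes cancel.\<close>

lemma hurwitz_pair_central: "p # p # zs @ ws \<approx> zs @ p # p # ws"
proof -
  have "p # p # zs @ ws \<approx> p # map (reflect_arrow p) zs @ p # ws"
    by (rule hurwitz_eq_Cons[OF hurwitz_move_past])
  also have "\<dots> \<approx> map (reflect_arrow p) (map (reflect_arrow p) zs) @ p # p # ws"
    by (rule hurwitz_move_past)
  finally show ?thesis by (simp add: comp_def)
qed

text \<open>The pair travels to the place in front of \<open>z\<close>, both copies are braided
  across \<open>z\<close>, and the reflected pair, which can move as freely, returns to the front;
  \<open>zs\<close> itself is restored.\<close>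

lemma hurwitz_pair_reflect:
  assumes "z \<in> set zs"
  shows "p # p # zs \<approx> reflect_arrow z p # reflect_arrow z p # zs"
proof -
  let ?p = "reflect_arrow z p"
  obtain z1 z2 where zs: "zs = z1 @ z # z2"
    using split_list[OF assms] by blast
  have "p # p # z1 @ z # z2 \<approx> z1 @ p # p # z # z2"
    by (rule hurwitz_pair_central)
  also have "\<dots> \<approx> z1 @ p # z # ?p # z2"
    using hurwitz_braid[of "z1 @ [p]" p z z2] by simp
  also have "\<dots> \<approx> z1 @ z # ?p # ?p # z2"
    by (rule hurwitz_braid)
  also have "z1 @ z # ?p # ?p # z2 \<approx> ?p # ?p # (z1 @ [z]) @ z2"
    using hurwitz_sym[OF hurwitz_pair_central[of ?p "z1 @ [z]" z2]] by simp
  finally show ?thesis by (simp add: zs)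
qed

lemma linkedD: "linked V xs \<Longrightarrow> S \<subseteq> V \<Longrightarrow> x \<in> S \<Longrightarrow> saturated xs S \<Longrightarrow> S = V"
  unfolding linked_def by blast

text \<open>Reflection at an arrow of \<open>zs\<close> fixes \<open>a\<close>, which lies outside
  \<open>W\<close>, and moves the other end along that arrow. The ends reachable from
  \<open>b\<close> therefore form a saturated set, which must be all of \<open>W\<close>.\<close>

lemma hurwitz_pair_change:
  assumes zs: "arrows_on W zs" "linked W zs" and b: "b \<in> W" "b' \<in> W" and a: "a \<notin> W"
  shows "(a, b) # (a, b) # zs \<approx> (a, b') # (a, b') # zs"
proof -
  let ?S = "{x \<in> W. (a, b) # (a, b) # zs \<approx> (a, x) # (a, x) # zs}"
  have step: "y \<in> ?S" if z: "z \<in> set zs" "z = (x, y) \<or> z = (y, x)" and x: "x \<in> ?S" for x y z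
  proof -
    have xy: "x \<in> W" "y \<in> W" "x \<noteq> y" using z zs by (auto simp: arrows_on_def)
    then have "reflect_arrow z (a, x) = (a, y)"
      using z a by (auto simp: reflect_arrow_def arrow_swap_def Transposition.transpose_def)
    then have "(a, x) # (a, x) # zs \<approx> (a, y) # (a, y) # zs"
      using hurwitz_pair_reflect[OF z(1), of "(a, x)"] by simp
    with x xy show ?thesis by (auto intro: hurwitz_trans)
  qed
  have "saturated zs ?S"
    unfolding saturated_def using step by blast
  moreover have "b \<in> ?S" using b by (simp add: hurwitz_refl)
  ultimately have "?S = W" using zs(2) linkedD[of W zs ?S b] by blast
  with b show ?thesis by blast
qed

section \<open>Splitting off one vertex\<close>

definition arrows_at :: "'a \<Rightarrow> ('a \<times> 'a) list \<Rightarrow> nat" where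
  "arrows_at a xs = length (filter (\<lambda>(s, t). s = a \<or> t = a) xs)"

text \<open>An arrow away from \<open>a\<close> has a swap fixing \<open>a\<close>. Moved to the
  right past the block of arrows at \<open>a\<close>, it changes only their far ends, so the number
  of arrows at \<open>a\<close> is kept.\<close>

lemma hurwitz_sort_at:
  "\<exists>bs zs. xs \<approx> map (Pair a) bs @ zs \<and> length bs = arrows_at a xs \<and> arrows_at a zs = 0"
proof (induction xs)
  case Nil
  then show ?case by (intro exI[of _ "[]"]) (simp add: hurwitz_refl arrows_at_def)
next
  case (Cons x xs)
  then obtain bs zs where IH: "xs \<approx> map (Pair a) bs @ zs" "length bs = arrows_at a xs"
    "arrows_at a zs = 0" by blast
  obtain s t where x: "x = (s, t)" by force
  have c: "x # xs \<approx> x # map (Pair a) bs @ zs" by (rule hurwitz_eq_Cons[OF IH(1)])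
  show ?case
  proof (cases "s = a \<or> t = a")
    case True
    then obtain b where b: "x = (a, b) \<or> x = (b, a)" using x by blast
    then have "x # map (Pair a) bs @ zs \<approx> (a, b) # map (Pair a) bs @ zs"
      using hurwitz_flip[of "[]" b a "map (Pair a) bs @ zs"] by (auto intro: hurwitz_refl)
    with c have "x # xs \<approx> map (Pair a) (b # bs) @ zs" by (auto intro: hurwitz_trans)
    moreover have "length (b # bs) = arrows_at a (x # xs)"
      using IH(2) True x by (simp add: arrows_at_def)
    ultimately show ?thesis using IH(3) by blast
  next
    case False
    have "map (reflect_arrow x) (map (Pair a) bs) = map (Pair a) (map (arrow_swap x) bs)"
      using False by (auto simp add: reflect_arrow_def arrow_swap_def Transposition.transpose_def x)
    with c hurwitz_move_past[of x "map (Pair a) bs" zs]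
    have "x # xs \<approx> map (Pair a) (map (arrow_swap x) bs) @ x # zs"
      by (metis hurwitz_trans)
    moreover have "arrows_at a (x # zs) = 0" "arrows_at a (x # xs) = arrows_at a xs"
      using IH(3) False x by (simp_all add: arrows_at_def)
    ultimately show ?thesis using IH(2) by (metis length_map)
  qed
qed

text \<open>One braid move turns \<open>(a, b)\<close> into its reflection at
  \<open>(a, b')\<close>, which is \<open>(b', b)\<close> and no longer meets
  \<open>a\<close>.\<close>

lemma hurwitz_reduce_at:
  assumes "b \<noteq> b'" "a \<noteq> b" "a \<noteq> b'"
  shows "\<exists>ys. xs @ (a, b) # (a, b') # zs \<approx> ys \<and>
    arrows_at a ys < arrows_at a (xs @ (a, b) # (a, b') # zs)"
proof -
  have "reflect_arrow (a, b') (a, b) = (b', b)"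
    using assms by (auto simp: reflect_arrow_def arrow_swap_def)
  then have "xs @ (a, b) # (a, b') # zs \<approx> xs @ (a, b') # (b', b) # zs"
    using hurwitz_braid[of xs "(a, b)" "(a, b')" zs] by simp
  moreover have "arrows_at a (xs @ (a, b') # (b', b) # zs) <
      arrows_at a (xs @ (a, b) # (a, b') # zs)"
    using assms by (simp add: arrows_at_def)
  ultimately show ?thesis by blast
qed

lemma not_const_adjacent:
  assumes "\<not> (\<exists>b. bs = replicate (length bs) b)"
  shows "\<exists>us b b' vs. bs = us @ b # b' # vs \<and> b \<noteq> b'"
  using assms
proof (induction bs)
  case (Cons x bs)
  show ?case
  proof (cases "\<exists>b. bs = replicate (length bs) b")
    case True
    then obtain b where b: "bs = replicate (length bs) b" ..
    show ?thesis
    proof (cases bs)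
      case (Cons y ys)
      with b have "y = b" by (metis length_Cons list.inject replicate_Suc)
      moreover have "x \<noteq> b"
        using Cons.prems b by (metis length_Cons replicate_Suc)
      ultimately have "x # bs = [] @ x # y # ys \<and> x \<noteq> y" using Cons by simp
      then show ?thesis by blast
    qed (use Cons.prems in auto)
  next
    case False
    with Cons.IH obtain us b b' vs where "bs = us @ b # b' # vs" "b \<noteq> b'" by blast
    then have "x # bs = (x # us) @ b # b' # vs \<and> b \<noteq> b'" by simp
    then show ?thesis by blast
  qed
qed simp

lemma linked_minus:
  assumes l: "linked V (replicate k (a, b) @ zs)" and zs: "arrows_on (V - {a}) zs"
    and V: "a \<in> V" "b \<in> V" "a \<noteq> b"
  shows "linked (V - {a}) zs"
  unfolding linked_def
proof (intro allI impI)
  fix S assume S: "S \<subseteq> V - {a}" "S \<noteq> {}" "saturated zs S"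
  \<comment> \<open>The discarded arrows all join \<open>a\<close> to \<open>b\<close>, so a
    saturated set of the whole sequence must contain \<open>a\<close> exactly when it contains
    \<open>b\<close>.\<close>
  define S' where "S' = (if b \<in> S then insert a S else S)"
  have "saturated (replicate k (a, b) @ zs) S'"
    using S zs V unfolding saturated_def S'_def arrows_on_def by fastforce
  moreover have "S' \<subseteq> V" "S' \<noteq> {}" using S V by (auto simp: S'_def)
  ultimately have "S' = V" using l unfolding linked_def by blast
  then show "S = V - {a}" using S V by (auto simp: S'_def split: if_splits)
qed

text \<open>Take an equivalent sequence with as few arrows at \<open>a\<close> as possible and move these to the front.
  Two neighbours among them with different other ends would permit a reduction, and so would three
  equal ones, since a pair of equal arrows can be moved to any other end.\<close>

lemma hurwitz_peel:
  assumes xs: "arrows_on V xs" "linked V xs" and a: "a \<in> V" and V: "V \<noteq> {a}"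
  obtains k b zs where "xs \<approx> replicate k (a, b) @ zs" "arrows_on (V - {a}) zs"
    "linked (V - {a}) zs" "b \<in> V - {a}" "k > 0" "V \<noteq> {a, b} \<Longrightarrow> k \<le> 2"
proof -
  obtain ys where ys: "xs \<approx> ys" and min: "\<And>ys'. xs \<approx> ys' \<Longrightarrow> arrows_at a ys \<le> arrows_at a ys'"
    using ex_has_least_nat[of "\<lambda>ys. xs \<approx> ys" xs "arrows_at a"] hurwitz_refl by blast
  obtain bs zs where bs: "ys \<approx> map (Pair a) bs @ zs" "length bs = arrows_at a ys"
    "arrows_at a zs = 0" using hurwitz_sort_at[of ys a] by blast
  let ?ys = "map (Pair a) bs @ zs"
  have eq: "xs \<approx> ?ys" using ys bs(1) by (rule hurwitz_trans)
  have at: "arrows_at a ?ys = arrows_at a ys"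
    using bs by (auto simp: arrows_at_def filter_map comp_def)
  have on: "arrows_on V ?ys" and lk: "linked V ?ys"
    using xs hurwitz_eq_arrows_on[OF eq] hurwitz_eq_linked[OF eq] by auto
  have bsV: "c \<in> V - {a}" if "c \<in> set bs" for c
    using on that by (force simp: arrows_on_def)
  have zs: "arrows_on (V - {a}) zs"
    using on bs(3) by (fastforce simp: arrows_on_def arrows_at_def filter_empty_conv)
  have noreduce: False if "xs \<approx> us @ (a, c) # (a, c') # ws" "c \<noteq> c'"
    "arrows_at a (us @ (a, c) # (a, c') # ws) = arrows_at a ys" for us c c' ws
  proof -
    have "c \<noteq> a" "c' \<noteq> a"
      using hurwitz_eq_arrows_on[OF that(1)] xs by (auto simp: arrows_on_def)
    then show False
      using hurwitz_reduce_at[of c c' a us ws] that min hurwitz_trans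
      by (metis leD)
  qed
  have "\<exists>b. bs = replicate (length bs) b"
  proof (rule ccontr)
    assume "\<not> ?thesis"
    then obtain us b b' vs where *: "bs = us @ b # b' # vs" "b \<noteq> b'"
      using not_const_adjacent by blast
    show False
      using noreduce[of "map (Pair a) us" b b' "map (Pair a) vs @ zs"] eq at * by simp
  qed
  then obtain b where b: "bs = replicate (length bs) b" ..
  define k where "k = length bs"
  have map: "map (Pair a) bs = replicate k (a, b)"
    by (subst b) (simp add: k_def)
  have k: "k > 0"
  proof (rule ccontr)
    \<comment> \<open>Without an arrow at \<open>a\<close> the set \<open>{a}\<close> would be
      saturated, although \<open>V\<close> has a further vertex.\<close>
    assume "\<not> k > 0"
    then have "saturated ?ys {a}"
      using zs map by (auto simp: saturated_def arrows_on_def)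
    then show False using lk a V unfolding linked_def by auto
  qed
  have bV: "b \<in> V - {a}" using bsV[of b] b k unfolding k_def
    by (metis in_set_replicate neq0_conv)
  have lz: "linked (V - {a}) zs"
    using linked_minus[of V k a b zs] lk zs a bV map by auto
  have "k \<le> 2" if "V \<noteq> {a, b}"
  proof (rule ccontr)
    assume "\<not> k \<le> 2"
    then obtain j where k3: "k = Suc j + 2" using less_imp_Suc_add[of 2 k] by auto
    have "\<not> V \<subseteq> {a, b}" using that bV a by auto
    then obtain b' where b': "b' \<in> V - {a}" "b' \<noteq> b" by blast
    let ?r = "replicate j (a, b)"
    have "replicate k (a, b) @ zs = (?r @ [(a, b)]) @ (a, b) # (a, b) # zs"
      unfolding k3 by (simp add: replicate_app_Cons_same)
    also have "\<dots> \<approx> (?r @ [(a, b)]) @ (a, b') # (a, b') # zs"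
      by (intro hurwitz_eq_append hurwitz_refl hurwitz_pair_change[OF zs lz]) (use bV b' in auto)
    finally have "xs \<approx> ?r @ (a, b) # (a, b') # (a, b') # zs"
      using eq map by (auto intro: hurwitz_trans)
    moreover have "arrows_at a (?r @ (a, b) # (a, b') # (a, b') # zs) = arrows_at a ys"
      using k3 bs unfolding k_def by (simp add: arrows_at_def)
    ultimately show False using noreduce b' by metis
  qed
  with that eq map zs lz bV k show thesis by metis
qed

section \<open>Hurwitz's theorem for transitive tuples of transpositions\<close>

lemma arrows_on_singleton: "arrows_on {a} xs \<Longrightarrow> xs = []"
  by (cases xs) (auto simp: arrows_on_def)

lemma monodromy_outside: "arrows_on V xs \<Longrightarrow> a \<notin> V \<Longrightarrow> monodromy xs a = a"
  by (induction xs) (auto simp: arrows_on_def arrow_swap_def Transposition.transpose_def)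

lemma bij_monodromy: "bij (monodromy xs)"
proof (induction xs)
  case (Cons w xs)
  have "bij (arrow_swap w)" by (simp add: arrow_swap_def)
  from bij_comp[OF this Cons] show ?case by (simp only: monodromy.simps)
qed (simp only: monodromy.simps bij_id)

lemma monodromy_permutes: "arrows_on V xs \<Longrightarrow> monodromy xs permutes V"
  using bij_monodromy[of xs] monodromy_outside[of V xs] unfolding permutes_def bij_iff by blast

lemma monodromy_replicate:
  "monodromy (replicate k w) = (if even k then id else arrow_swap w)"
  by (induction k) (auto simp: fun_eq_iff)

text \<open>Induction on the number of vertices by splitting off the same \<open>a\<close> from both
  sequences. What has to be shown is that the multiplicities \<open>k\<close>, \<open>l\<close>
  agree and that the neighbours \<open>b\<close>, \<open>c\<close> can be made equal; then the
  remaining sequences have equal length and product.\<close>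

theorem hurwitz_transpositions:
  assumes "finite V" "V \<noteq> {}" "arrows_on V xs" "linked V xs" "arrows_on V ys" "linked V ys"
    "length xs = length ys" "monodromy xs = monodromy ys"
  shows "xs \<approx> ys"
  using assms
proof (induction "card V" arbitrary: V xs ys rule: less_induct)
  case less
  obtain a where a: "a \<in> V" using less.prems by blast
  show ?case
  proof (cases "V = {a}")
    case True
    then have "xs = []" "ys = []" using less.prems arrows_on_singleton by metis+
    then show ?thesis by (simp add: hurwitz_refl)
  next
    case False
    obtain k b zs where x: "xs \<approx> replicate k (a, b) @ zs" "arrows_on (V - {a}) zs"
      "linked (V - {a}) zs" "b \<in> V - {a}" "k > 0" "V \<noteq> {a, b} \<Longrightarrow> k \<le> 2"
      using hurwitz_peel[OF less.prems(3,4) a False] by metis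
    obtain l c ws where y: "ys \<approx> replicate l (a, c) @ ws" "arrows_on (V - {a}) ws"
      "linked (V - {a}) ws" "c \<in> V - {a}" "l > 0" "V \<noteq> {a, c} \<Longrightarrow> l \<le> 2"
      using hurwitz_peel[OF less.prems(5,6) a False] by metis
    have len: "k + length zs = l + length ws"
      using hurwitz_eq_length[OF x(1)] hurwitz_eq_length[OF y(1)] less.prems by simp
    let ?t = "\<lambda>k b. monodromy (replicate k (a, b))"
    have mon: "monodromy zs \<circ> ?t k b = monodromy ws \<circ> ?t l c"
      using hurwitz_eq_monodromy[OF x(1)] hurwitz_eq_monodromy[OF y(1)] less.prems
      by (simp add: monodromy_append)
    have fx: "monodromy zs a = a" "monodromy ws a = a"
      using monodromy_outside x y by (metis Diff_iff insertI1)+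
    have tt: "?t k b (?t k b v) = v" for k b v by (simp add: monodromy_replicate)
    \<comment> \<open>Both sides are the preimage of \<open>a\<close> under the common product,
      because \<open>zs\<close> and \<open>ws\<close> fix \<open>a\<close>. This yields the parity
      of the multiplicity and, if it is odd, the neighbour.\<close>
    have "?t k b a = ?t l c a"
    proof -
      have "monodromy zs (?t k b (?t k b a)) = a" using tt fx by simp
      moreover have "monodromy ws (?t l c (?t l c a)) = a" using tt fx by simp
      ultimately have "monodromy ws (?t l c (?t k b a)) = monodromy ws (?t l c (?t l c a))"
        using mon by (metis comp_apply)
      then show ?thesis
        using bij_monodromy by (metis bij_def inj_eq)
    qed
    then have parity: "even k = even l" and bc: "odd k \<Longrightarrow> b = c"
      using x(4) y(4) by (auto simp: monodromy_replicate arrow_swap_def split: if_splits)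
    have teq: "?t k b = ?t l c" using parity bc by (simp add: monodromy_replicate)
    have meq: "monodromy zs = monodromy ws"
    proof
      fix v show "monodromy zs v = monodromy ws v"
        using mon tt teq by (metis comp_apply)
    qed
    \<comment> \<open>On two vertices no arrow remains and the total length decides; otherwise both
      numbers are 1 or 2, and parity decides.\<close>
    have kl: "k = l"
    proof (cases "V = {a, b}")
      case True
      then have "V - {a} = {b}" using x(4) by auto
      then have "zs = []" "ws = []" using x y arrows_on_singleton by metis+
      then show ?thesis using len by simp
    next
      case False
      moreover from this have "V \<noteq> {a, c}" using x(4) y(4)
        by auto
      ultimately have "k \<le> 2" "l \<le> 2" using x y by auto
      with x(5) y(5) parity show ?thesis
        by (metis One_nat_def Suc_leI even_numeral le_Suc_eq le_antisym numeral_2_eq_2 odd_one)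
    qed
    have IH: "zs \<approx> ws"
    proof (rule less.hyps[of "V - {a}"])
      show "card (V - {a}) < card V" using less.prems a by (intro card_Diff1_less)
    qed (use less.prems x y len kl meq in auto)
    \<comment> \<open>Different neighbours are possible only for even multiplicity, which is then 2,
      and a pair can be moved to the other end.\<close>
    have "replicate k (a, b) @ zs \<approx> replicate k (a, c) @ zs"
    proof (cases "b = c")
      case False
      then have "even k" "V \<noteq> {a, b}" using bc y by auto
      then have "k = 2" using x by (metis dvd_imp_le le_antisym)
      then show ?thesis
        using hurwitz_pair_change[OF x(2,3,4) y(4)] by (simp add: numeral_2_eq_2)
    qed (simp add: hurwitz_refl)
    also have "\<dots> \<approx> replicate k (a, c) @ ws"
      by (intro hurwitz_eq_append hurwitz_refl IH)
    finally show ?thesis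
      using x(1) y(1) kl by (metis hurwitz_sym hurwitz_trans)
  qed
qed

section \<open>Cycle types\<close>

definition cells :: "nat list \<Rightarrow> (nat \<times> nat) set" where
  "cells \<pi> = (SIGMA t:{..<length \<pi>}. {..<\<pi> ! t})"

text \<open>Rows of the diagram \<open>cells \<pi>\<close> are the cycles, fixed points being rows
  of length 1. The parametrisation \<open>h\<close> replaces orbits by index arithmetic, and the
  rows may come in any order, which the inductive constructions need.\<close>

definition cycle_type :: "'a set \<Rightarrow> ('a \<Rightarrow> 'a) \<Rightarrow> nat list \<Rightarrow> bool" where
  "cycle_type V c \<pi> \<longleftrightarrow> (\<forall>p \<in> set \<pi>. p > 0) \<and>
     (\<exists>h. bij_betw h (cells \<pi>) V \<and>
        (\<forall>(t, i) \<in> cells \<pi>. c (h (t, i)) = h (t, Suc i mod \<pi> ! t)))"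

lemma finite_cells [simp]: "finite (cells \<pi>)"
  by (simp add: cells_def)

lemma mem_cells [simp]: "(t, i) \<in> cells \<pi> \<longleftrightarrow> t < length \<pi> \<and> i < \<pi> ! t"
  by (simp add: cells_def)

lemma cycle_typeE:
  assumes "cycle_type V c \<pi>"
  obtains h where "bij_betw h (cells \<pi>) V"
    "\<And>t i. t < length \<pi> \<Longrightarrow> i < \<pi> ! t \<Longrightarrow> c (h (t, i)) = h (t, Suc i mod \<pi> ! t)"
proof -
  obtain h where "bij_betw h (cells \<pi>) V"
    "\<forall>(t, i) \<in> cells \<pi>. c (h (t, i)) = h (t, Suc i mod \<pi> ! t)"
    using assms unfolding cycle_type_def by blast
  then show thesis by (intro that[of h]) auto
qed

lemma cycle_typeI:
  assumes "\<And>p. p \<in> set \<pi> \<Longrightarrow> p > 0" "bij_betw h (cells \<pi>) V"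
    "\<And>t i. t < length \<pi> \<Longrightarrow> i < \<pi> ! t \<Longrightarrow> c (h (t, i)) = h (t, Suc i mod \<pi> ! t)"
  shows "cycle_type V c \<pi>"
  unfolding cycle_type_def using assms by (intro conjI exI[of _ h]) auto

lemma cycle_type_pos: "cycle_type V c \<pi> \<Longrightarrow> p \<in> set \<pi> \<Longrightarrow> p > 0"
  by (simp add: cycle_type_def)

text \<open>The \<open>k\<close>-th power rotates each row by \<open>k\<close> places: it fixes a
  row pointwise if the row length divides \<open>k\<close>, and fixes no point of it
  otherwise.\<close>

lemma cycle_type_card_fixed:
  assumes "cycle_type V c \<pi>"
  shows "card {x \<in> V. (c ^^ k) x = x} = (\<Sum>p\<leftarrow>\<pi>. if p dvd k then p else 0)"
proof -
  obtain h where h: "bij_betw h (cells \<pi>) V"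
    "\<And>t i. t < length \<pi> \<Longrightarrow> i < \<pi> ! t \<Longrightarrow> c (h (t, i)) = h (t, Suc i mod \<pi> ! t)"
    using cycle_typeE[OF assms] by metis
  have pow: "(c ^^ k) (h (t, i)) = h (t, (i + k) mod \<pi> ! t)" if "t < length \<pi>" "i < \<pi> ! t" for t i k
  proof (induction k)
    case (Suc k)
    have "(i + k) mod \<pi> ! t < \<pi> ! t" using that by simp
    then show ?case using Suc h(2)[of t "(i + k) mod \<pi> ! t"] that by (simp add: mod_simps)
  qed (use that in simp)
  have fixed: "(c ^^ k) (h (t, i)) = h (t, i) \<longleftrightarrow> \<pi> ! t dvd k" if "(t, i) \<in> cells \<pi>" for t i
  proof -
    have "(c ^^ k) (h (t, i)) = h (t, i) \<longleftrightarrow> (t, (i + k) mod \<pi> ! t) = (t, i)"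
      using pow[of t i k] inj_on_eq_iff[OF bij_betw_imp_inj_on[OF h(1)], of "(t, (i + k) mod \<pi> ! t)" "(t, i)"] that
      by auto
    also have "\<dots> \<longleftrightarrow> (i + k) mod \<pi> ! t = i mod \<pi> ! t"
      using that by simp
    also have "\<dots> \<longleftrightarrow> \<pi> ! t dvd k"
      by (subst mod_eq_dvd_iff_nat) auto
    finally show ?thesis .
  qed
  let ?C = "SIGMA t:{t. t < length \<pi> \<and> \<pi> ! t dvd k}. {..<\<pi> ! t}"
  have sub: "?C \<subseteq> cells \<pi>" by auto
  have "{x \<in> V. (c ^^ k) x = x} = h ` {z \<in> cells \<pi>. (c ^^ k) (h z) = h z}"
    using h(1) by (auto simp: bij_betw_def)
  also have "{z \<in> cells \<pi>. (c ^^ k) (h z) = h z} = ?C"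
    using fixed by (auto simp: cells_def)
  also have "card (h ` ?C) = card ?C"
    using h(1) sub by (intro card_image) (auto simp: bij_betw_def intro: inj_on_subset)
  also have "\<dots> = (\<Sum>t | t < length \<pi> \<and> \<pi> ! t dvd k. \<pi> ! t)"
    by (subst card_SigmaI) auto
  also have "\<dots> = (\<Sum>t<length \<pi>. if \<pi> ! t dvd k then \<pi> ! t else 0)"
    by (subst sum.inter_filter[symmetric]) (auto intro!: sum.cong)
  also have "\<dots> = (\<Sum>p\<leftarrow>\<pi>. if p dvd k then p else 0)"
    by (simp add: sum_list_sum_nth lessThan_atLeast0)
  finally show ?thesis .
qed

lemma cycle_type_mset:
  assumes "cycle_type V c \<pi>" "mset \<pi>' = mset \<pi>"
  shows "cycle_type V c \<pi>'"
proof -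
  obtain h where h: "bij_betw h (cells \<pi>) V"
    "\<And>t i. t < length \<pi> \<Longrightarrow> i < \<pi> ! t \<Longrightarrow> c (h (t, i)) = h (t, Suc i mod \<pi> ! t)"
    using cycle_typeE[OF assms(1)] by metis
  have len: "length \<pi>' = length \<pi>" using assms(2) by (rule mset_eq_length)
  obtain f where f: "f permutes {..<length \<pi>}" "permute_list f \<pi> = \<pi>'"
    using assms(2) by (rule mset_eq_permutation)
  have nth: "\<pi>' ! t = \<pi> ! f t" if "t < length \<pi>" for t
    using permute_list_nth[OF f(1) that] f(2) by simp
  have ft: "f t < length \<pi> \<longleftrightarrow> t < length \<pi>" for t
    using permutes_in_image[OF f(1)] by auto
  have "bij_betw (\<lambda>(t, i). (f t, i)) (cells \<pi>') (cells \<pi>)"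
  proof (rule bij_betw_byWitness[where f' = "\<lambda>(t, i). (inv_into UNIV f t, i)"])
    have "inv_into UNIV f t < length \<pi> \<longleftrightarrow> t < length \<pi>" for t
      using permutes_in_image[OF permutes_inv[OF f(1)]] by auto
    then show "(\<lambda>(t, i). (inv_into UNIV f t, i)) ` cells \<pi> \<subseteq> cells \<pi>'"
      using len nth permutes_inverses[OF f(1)] by auto
  qed (use len nth ft permutes_inverses[OF f(1)] in auto)
  from bij_betw_trans[OF this h(1)] show ?thesis
  proof (rule cycle_typeI[rotated])
    show "p > 0" if "p \<in> set \<pi>'" for p
      using that assms cycle_type_pos by (metis set_mset_mset)
    show "c ((h \<circ> (\<lambda>(t, i). (f t, i))) (t, i)) = (h \<circ> (\<lambda>(t, i). (f t, i))) (t, Suc i mod \<pi>' ! t)"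
      if "t < length \<pi>'" "i < \<pi>' ! t" for t i
      using that h(2)[of "f t" i] len nth ft by simp
  qed
qed

lemma cycle_type_conjugate:
  assumes "cycle_type V c \<pi>" "cycle_type W c' \<pi>"
  obtains \<sigma> where "bij_betw \<sigma> V W" "\<And>x. x \<in> V \<Longrightarrow> \<sigma> (c x) = c' (\<sigma> x)"
proof -
  obtain h where h: "bij_betw h (cells \<pi>) V"
    "\<And>t i. t < length \<pi> \<Longrightarrow> i < \<pi> ! t \<Longrightarrow> c (h (t, i)) = h (t, Suc i mod \<pi> ! t)"
    using cycle_typeE[OF assms(1)] by metis
  obtain g where g: "bij_betw g (cells \<pi>) W"
    "\<And>t i. t < length \<pi> \<Longrightarrow> i < \<pi> ! t \<Longrightarrow> c' (g (t, i)) = g (t, Suc i mod \<pi> ! t)"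
    using cycle_typeE[OF assms(2)] by metis
  define \<sigma> where "\<sigma> = g \<circ> inv_into (cells \<pi>) h"
  have \<sigma>h: "\<sigma> (h z) = g z" if "z \<in> cells \<pi>" for z
    using that h(1) by (simp add: \<sigma>_def bij_betw_def inv_into_f_f)
  have "bij_betw \<sigma> V W"
    unfolding \<sigma>_def by (rule bij_betw_trans[OF bij_betw_inv_into[OF h(1)] g(1)])
  moreover have "\<sigma> (c x) = c' (\<sigma> x)" if xV: "x \<in> V" for x
  proof -
    obtain z where z: "x = h z" "z \<in> cells \<pi>"
      using xV h(1) by (auto simp: bij_betw_def)
    obtain t i where ti: "z = (t, i)" by force
    have x: "x = h (t, i)" "(t, i) \<in> cells \<pi>" using z unfolding ti by auto
    moreover have "(t, Suc i mod \<pi> ! t) \<in> cells \<pi>" using x(2) by auto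
    ultimately show ?thesis using h(2) g(2) \<sigma>h by (metis mem_cells)
  qed
  ultimately show thesis by (rule that)
qed

section \<open>Inserting a point into a permutation, and the genus formula\<close>

lemma bij_betw_fun_upd_insert:
  assumes "bij_betw h A (V - {a})" "z \<notin> A" "a \<in> V"
  shows "bij_betw (h(z := a)) (insert z A) V"
proof -
  have "bij_betw (h(z := a)) A (V - {a})"
    using assms by (subst bij_betw_cong[where g = h]) auto
  then have "bij_betw (h(z := a)) (A \<union> {z}) (V - {a} \<union> {a})"
    using assms notIn_Un_bij_betw[of z A "h(z := a)" "V - {a}"] by simp
  moreover have "V - {a} \<union> {a} = V" using assms by auto
  ultimately show ?thesis by simp
qed

lemma cycle_type_add_fixed:
  assumes "cycle_type (V - {a}) c \<pi>" "c a = a" "a \<in> V"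
  shows "cycle_type V c (\<pi> @ [1])"
proof -
  obtain h where h: "bij_betw h (cells \<pi>) (V - {a})"
    "\<And>t i. t < length \<pi> \<Longrightarrow> i < \<pi> ! t \<Longrightarrow> c (h (t, i)) = h (t, Suc i mod \<pi> ! t)"
    using cycle_typeE[OF assms(1)] by metis
  have cells: "cells (\<pi> @ [1]) = insert (length \<pi>, 0) (cells \<pi>)"
    by (auto simp: nth_append split: if_splits)
  show ?thesis
  proof (rule cycle_typeI)
    show "bij_betw (h((length \<pi>, 0) := a)) (cells (\<pi> @ [1])) V"
      unfolding cells by (rule bij_betw_fun_upd_insert) (use h assms in auto)
    show "c ((h((length \<pi>, 0) := a)) (t, i)) =
        (h((length \<pi>, 0) := a)) (t, Suc i mod (\<pi> @ [1]) ! t)"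
      if "t < length (\<pi> @ [1])" "i < (\<pi> @ [1]) ! t" for t i
      using that h(2)[of t i] assms(2) by (cases "t < length \<pi>") (auto simp: nth_append)
  qed (use cycle_type_pos[OF assms(1)] in auto)
qed

text \<open>Prepares the insertion of a new point after \<open>b\<close>: a cycle can be read from
  any starting point, so \<open>b\<close> may be put at the end of its row, where appending is
  easy.\<close>

lemma cycle_type_rotate:
  assumes "cycle_type V c \<pi>" "b \<in> V"
  obtains h t where "bij_betw h (cells \<pi>) V"
    "\<And>t i. t < length \<pi> \<Longrightarrow> i < \<pi> ! t \<Longrightarrow> c (h (t, i)) = h (t, Suc i mod \<pi> ! t)"
    "t < length \<pi>" "h (t, \<pi> ! t - 1) = b"
proof -
  obtain h where h: "bij_betw h (cells \<pi>) V"
    "\<And>t i. t < length \<pi> \<Longrightarrow> i < \<pi> ! t \<Longrightarrow> c (h (t, i)) = h (t, Suc i mod \<pi> ! t)"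
    using cycle_typeE[OF assms(1)] by metis
  obtain u j where b: "b = h (u, j)" "u < length \<pi>" "j < \<pi> ! u"
    using assms(2) h(1) by (force simp: bij_betw_def)
  \<comment> \<open>The shift by \<open>Suc j\<close> sends the last position
    \<open>\<pi> ! u - 1\<close> to \<open>j\<close>, the old position of \<open>b\<close>.\<close>
  define \<rho> where "\<rho> = (\<lambda>(t, i). if t = u then (t, (i + Suc j) mod \<pi> ! u) else (t, i))"
  have sub: "\<rho> ` cells \<pi> \<subseteq> cells \<pi>"
    using b by (auto simp: \<rho>_def)
  moreover have "cells \<pi> \<subseteq> \<rho> ` cells \<pi>"
  proof
    fix z assume z: "z \<in> cells \<pi>"
    obtain t i where ti: "z = (t, i)" by force
    show "z \<in> \<rho> ` cells \<pi>"
    proof (cases "t = u")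
      case True
      let ?i = "(i + (\<pi> ! u - Suc j)) mod \<pi> ! u"
      have "(?i + Suc j) mod \<pi> ! u = (i + (\<pi> ! u - Suc j) + Suc j) mod \<pi> ! u"
        by (rule mod_add_left_eq)
      also have "i + (\<pi> ! u - Suc j) + Suc j = i + \<pi> ! u" using b by simp
      also have "(i + \<pi> ! u) mod \<pi> ! u = i" using z ti True by simp
      finally have "z = \<rho> (u, ?i)" using ti True by (simp add: \<rho>_def)
      moreover have "(u, ?i) \<in> cells \<pi>" using b by simp
      ultimately show ?thesis by blast
    next
      case False
      then have "\<rho> z = z" by (simp add: \<rho>_def ti)
      then show ?thesis using z by force
    qed
  qed
  ultimately have im: "\<rho> ` cells \<pi> = cells \<pi>" ..
  then have "bij_betw \<rho> (cells \<pi>) (cells \<pi>)"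
    by (simp add: bij_betw_def eq_card_imp_inj_on)
  from bij_betw_trans[OF this h(1)] have "bij_betw (h \<circ> \<rho>) (cells \<pi>) V" .
  moreover have "c ((h \<circ> \<rho>) (t, i)) = (h \<circ> \<rho>) (t, Suc i mod \<pi> ! t)"
    if ti: "t < length \<pi>" "i < \<pi> ! t" for t i
  proof (cases "t = u")
    case True
    have "(i + Suc j) mod \<pi> ! u < \<pi> ! u" using ti True by simp
    moreover have "Suc ((i + Suc j) mod \<pi> ! u) mod \<pi> ! u = (Suc i mod \<pi> ! u + Suc j) mod \<pi> ! u"
      by (simp only: mod_Suc_eq mod_add_left_eq add_Suc)
    ultimately show ?thesis
      using True h(2)[OF b(2)] by (simp add: \<rho>_def del: add_Suc_right)
  qed (use h(2)[OF ti] in \<open>simp add: \<rho>_def\<close>)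
  moreover have "u < length \<pi>" by (fact b(2))
  moreover have "(h \<circ> \<rho>) (u, \<pi> ! u - 1) = b"
  proof -
    have "\<pi> ! u - 1 + Suc j = j + \<pi> ! u" using b by simp
    then show ?thesis using b by (simp add: \<rho>_def del: add_Suc_right)
  qed
  ultimately show thesis by (rule that)
qed

text \<open>The composite sends \<open>b\<close> to \<open>a\<close> and \<open>a\<close> to
  \<open>D b\<close>, so \<open>a\<close> is inserted right after \<open>b\<close> in the cycle of
  \<open>b\<close> and no cycle is created or lost.\<close>

lemma cycle_type_insert:
  assumes D: "cycle_type (V - {a}) D \<pi>" "D a = a" and b: "b \<in> V - {a}" and a: "a \<in> V"
  shows "\<exists>\<pi>'. length \<pi>' = length \<pi> \<and> cycle_type V (D \<circ> arrow_swap (a, b)) \<pi>'"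
proof -
  obtain h u where h: "bij_betw h (cells \<pi>) (V - {a})"
    "\<And>t i. t < length \<pi> \<Longrightarrow> i < \<pi> ! t \<Longrightarrow> D (h (t, i)) = h (t, Suc i mod \<pi> ! t)"
    and u: "u < length \<pi>" "h (u, \<pi> ! u - 1) = b"
    using cycle_type_rotate[OF D(1) b] by metis
  let ?p = "\<pi> ! u" and ?\<pi> = "\<pi>[u := Suc (\<pi> ! u)]"
  define g where "g = h((u, ?p) := a)"
  have p: "?p > 0" using cycle_type_pos[OF D(1)] u by simp
  have cells: "cells ?\<pi> = insert (u, ?p) (cells \<pi>)"
    using u by (auto simp: nth_list_update split: if_splits)
  have hb: "h (t, i) = b \<longleftrightarrow> t = u \<and> i = ?p - 1" if "(t, i) \<in> cells \<pi>" for t i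
    using h(1) u p that unfolding bij_betw_def inj_on_def by fastforce
  have ha: "h (t, i) \<noteq> a" if "(t, i) \<in> cells \<pi>" for t i
    using h(1) that by (auto simp: bij_betw_def)
  have "cycle_type V (D \<circ> arrow_swap (a, b)) ?\<pi>"
  proof (rule cycle_typeI)
    show "bij_betw g (cells ?\<pi>) V"
      unfolding cells g_def by (rule bij_betw_fun_upd_insert) (use h a in auto)
    show "p > 0" if "p \<in> set ?\<pi>" for p
      using that cycle_type_pos[OF D(1)] set_update_subset_insert by fastforce
    fix t i assume ti: "t < length ?\<pi>" "i < ?\<pi> ! t"
    consider "t \<noteq> u \<or> i < ?p - 1" | "t = u" "i = ?p - 1" | "t = u" "i = ?p"
      using ti u p by (auto simp: nth_list_update split: if_splits) linarith
    then show "(D \<circ> arrow_swap (a, b)) (g (t, i)) = g (t, Suc i mod ?\<pi> ! t)"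
    proof cases
      case 1
      have c: "(t, i) \<in> cells \<pi>" using ti 1 u by (cases "t = u") auto
      then have "arrow_swap (a, b) (h (t, i)) = h (t, i)"
        using hb[OF c] ha[OF c] 1 by (auto simp: arrow_swap_def)
      moreover have "Suc i mod ?\<pi> ! t = Suc i mod \<pi> ! t"
        using 1 u by (cases "t = u") auto
      moreover have "(t, Suc i mod \<pi> ! t) \<in> cells \<pi>"
        using c by auto
      ultimately show ?thesis
        using h(2)[of t i] c u(1) by (auto simp: g_def)
    next
      case 2
      moreover from p have "?p - 1 \<noteq> ?p" by simp
      ultimately show ?thesis using u p D(2) b by (simp add: g_def arrow_swap_def)
    next
      case 3
      then show ?thesis using u p h(2)[of u "?p - 1"] by (simp add: g_def arrow_swap_def)
    qed
  qed
  then show ?thesis by (intro exI[of _ ?\<pi>]) simp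
qed

text \<open>Splitting off a vertex with an even number \<open>2 * j\<close> of arrows creates a
  fixed point and raises the genus by \<open>j - 1\<close>; with \<open>2 * j + 1\<close> arrows it
  lengthens a cycle and raises the genus by \<open>j\<close>. In both cases the genus stays a
  natural number.\<close>

lemma riemann_hurwitz:
  assumes "finite V" "V \<noteq> {}" "arrows_on V xs" "linked V xs"
  shows "\<exists>\<pi> d. cycle_type V (monodromy xs) \<pi> \<and> length xs + 2 = card V + length \<pi> + 2 * d"
  using assms
proof (induction "card V" arbitrary: V xs rule: less_induct)
  case less
  obtain a where a: "a \<in> V" using less.prems by blast
  show ?case
  proof (cases "V = {a}")
    case True
    then have xs: "xs = []" using less.prems arrows_on_singleton by metis
    have "cells [1] = {(0, 0)}" by (auto simp: cells_def)
    then have "cycle_type V (monodromy xs) [1]"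
      using True xs by (intro cycle_typeI[of _ "\<lambda>_. a"]) (auto simp: bij_betw_def)
    then show ?thesis using True xs by (intro exI[of _ "[1]"] exI[of _ 0]) simp
  next
    case False
    obtain k b zs where x: "xs \<approx> replicate k (a, b) @ zs" "arrows_on (V - {a}) zs"
      "linked (V - {a}) zs" "b \<in> V - {a}" "k > 0"
      using hurwitz_peel[OF less.prems(3,4) a False] by metis
    have len: "length xs = k + length zs"
      using hurwitz_eq_length[OF x(1)] by simp
    have mon: "monodromy xs = monodromy zs \<circ> (if even k then id else arrow_swap (a, b))"
      using hurwitz_eq_monodromy[OF x(1)] by (simp add: monodromy_append monodromy_replicate)
    have fx: "monodromy zs a = a"
      using monodromy_outside x by (metis Diff_iff insertI1)
    have cV: "card V = Suc (card (V - {a}))"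
      using less.prems a by (intro card.remove)
    then have "\<exists>\<pi> d. cycle_type (V - {a}) (monodromy zs) \<pi> \<and>
        length zs + 2 = card (V - {a}) + length \<pi> + 2 * d"
      using x less.prems by (intro less.hyps) auto
    then obtain \<pi> d where IH: "cycle_type (V - {a}) (monodromy zs) \<pi>"
      "length zs + 2 = card (V - {a}) + length \<pi> + 2 * d" by blast
    show ?thesis
    proof (cases "even k")
      case True
      then obtain j where j: "k = 2 * j" by auto
      have "cycle_type V (monodromy xs) (\<pi> @ [1])"
        using cycle_type_add_fixed[OF IH(1) fx a] mon True by simp
      \<comment> \<open>Since \<open>k > 0\<close>, the number \<open>j\<close> is positive and the
        subtraction does not truncate.\<close>
      moreover have "length xs + 2 = card V + length (\<pi> @ [1]) + 2 * (d + j - 1)"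
        using len IH(2) cV j x(5) by simp
      ultimately show ?thesis by blast
    next
      case False
      then obtain j where j: "k = Suc (2 * j)" by (auto elim: oddE)
      obtain \<pi>' where "length \<pi>' = length \<pi>" "cycle_type V (monodromy xs) \<pi>'"
        using cycle_type_insert[OF IH(1) fx x(4) a] mon False by auto
      moreover from this have "length xs + 2 = card V + length \<pi>' + 2 * (d + j)"
        using len IH(2) cV j by simp
      ultimately show ?thesis by blast
    qed
  qed
qed

text \<open>The least part is the least positive \<open>k\<close> with a non-zero sum. It therefore
  agrees for both lists and can be removed from both.\<close>

lemma sorted_divisor_sums_unique:
  fixes xs ys :: "nat list"
  assumes "sorted xs" "sorted ys" "\<And>p. p \<in> set xs \<union> set ys \<Longrightarrow> p > 0"
    "\<And>k. (\<Sum>p\<leftarrow>xs. if p dvd k then p else 0) = (\<Sum>p\<leftarrow>ys. if p dvd k then p else 0)"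
  shows "xs = ys"
proof -
  let ?F = "\<lambda>xs k. \<Sum>p\<leftarrow>xs. if p dvd k then p else (0::nat)"
  have le: "y \<le> x" if "?F (x # xs) = ?F (y # ys)" "sorted (y # ys)" "x > 0" for x y xs ys
  proof -
    have "?F (x # xs) x > 0" using that(3) by simp
    then have "?F (y # ys) x \<noteq> 0" using that(1) by (metis less_numeral_extra(3))
    then obtain z where z: "z \<in> set (y # ys)" "z dvd x" by (auto split: if_splits)
    then have "y \<le> z" using that(2) by auto
    also have "z \<le> x" using z that(3) by (intro dvd_imp_le)
    finally show ?thesis .
  qed
  have ne: "?F (x # xs) \<noteq> ?F []" if "x > 0" for x xs
  proof
    assume "?F (x # xs) = ?F []"
    from fun_cong[OF this, of x] that show False by simp
  qed
  show ?thesis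
    using assms
  proof (induction xs arbitrary: ys)
    case Nil
    have "?F [] = ?F ys" using Nil(4) by (rule ext)
    show ?case
    proof (cases ys)
      case (Cons y ys')
      then have "y > 0" using Nil(3) by simp
      then show ?thesis using ne[of y ys'] \<open>?F [] = ?F ys\<close> Cons by simp
    qed simp
  next
    case (Cons x xs)
    note prems = Cons.prems
    have F: "?F (x # xs) = ?F ys" using prems(4) by (rule ext)
    have "x > 0" using prems by simp
    then obtain y ys' where ys: "ys = y # ys'"
      using F ne[of x xs] by (cases ys) simp_all
    have "x = y"
    proof (rule antisym)
      show "y \<le> x" using le[of x xs y ys'] F prems(2) \<open>x > 0\<close> unfolding ys by simp
      show "x \<le> y" using le[of y ys' x xs] F prems(1,3) unfolding ys by simp
    qed
    have "xs = ys'"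
    proof (rule Cons.IH)
      show "(\<Sum>p\<leftarrow>xs. if p dvd k then p else 0) = (\<Sum>p\<leftarrow>ys'. if p dvd k then p else 0)" for k
        using prems(4)[of k] ys \<open>x = y\<close> by simp
    qed (use prems ys in auto)
    with \<open>x = y\<close> ys show ?case by simp
  qed
qed

section \<open>Congruence of upper Gram matrices\<close>

definition incidence :: "'a \<times> 'a \<Rightarrow> 'a \<Rightarrow> int" where
  "incidence w v = of_bool (fst w = v) - of_bool (snd w = v)"

text \<open>The inner product of the two incidence vectors, written by evaluation at the ends of
  \<open>w\<close>, so that no finite vertex set has to be fixed.\<close>

definition arrow_ip :: "'a \<times> 'a \<Rightarrow> 'a \<times> 'a \<Rightarrow> int" where
  "arrow_ip u w = incidence u (fst w) - incidence u (snd w)"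

definition arrow_gram :: "('a \<times> 'a) list \<Rightarrow> int mat" where
  "arrow_gram xs = mat (length xs) (length xs)
     (\<lambda>(i, j). if i = j then 1 else if i < j then arrow_ip (xs ! i) (xs ! j) else 0)"

lemma arrow_gram_carrier [simp]: "arrow_gram xs \<in> carrier_mat (length xs) (length xs)"
  by (simp add: arrow_gram_def)

lemma arrow_ip_commute: "arrow_ip u w = arrow_ip w u"
  by (auto simp: arrow_ip_def incidence_def)

text \<open>The swap read as a reflection: \<open>f (fst w) - f (snd w)\<close> is the pairing of
  \<open>f\<close> with the incidence vector of \<open>w\<close>.\<close>

lemma apply_arrow_swap:
  fixes f :: "'a \<Rightarrow> int"
  shows "f (arrow_swap w v) = f v - incidence w v * (f (fst w) - f (snd w))"
  by (auto simp: arrow_swap_def Transposition.transpose_def incidence_def)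

lemma arrow_ip_reflect: "arrow_ip z (reflect_arrow w u) = arrow_ip z u - arrow_ip u w * arrow_ip z w"
proof -
  have "arrow_ip z (reflect_arrow w u) = incidence z (arrow_swap w (fst u)) - incidence z (arrow_swap w (snd u))"
    by (simp add: arrow_ip_def reflect_arrow_def)
  also have "\<dots> = arrow_ip z u - arrow_ip w u * arrow_ip z w"
    by (simp add: apply_arrow_swap arrow_ip_def algebra_simps)
  finally show ?thesis by (simp add: arrow_ip_commute)
qed

lemma arrow_ip_flip: "arrow_ip u (prod.swap w) = - arrow_ip u w" "arrow_ip (prod.swap w) u = - arrow_ip w u"
  by (auto simp: arrow_ip_def incidence_def)

section \<open>Congruence of integer matrices\<close>

definition mat_congruent :: "nat \<Rightarrow> int mat \<Rightarrow> int mat \<Rightarrow> bool" where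
  "mat_congruent n A A' \<longleftrightarrow>
     (\<exists>B \<in> carrier_mat n n. invertible_mat B \<and> A' = transpose_mat B * A * B)"

lemma invertible_matE:
  assumes "invertible_mat B" "B \<in> carrier_mat n n"
  obtains C where "C \<in> carrier_mat n n" "B * C = 1\<^sub>m n" "C * B = 1\<^sub>m n"
proof -
  obtain C where C: "B * C = 1\<^sub>m n" "C * B = 1\<^sub>m (dim_row C)"
    using assms unfolding invertible_mat_def inverts_mat_def by auto
  have "dim_col (B * C) = n" "dim_col (C * B) = dim_row C"
    unfolding C by simp_all
  then have "C \<in> carrier_mat n n" using assms(2) by auto
  with C show thesis by (intro that) auto
qed

lemma invertible_matI:
  assumes "B \<in> carrier_mat n n" "C \<in> carrier_mat n n" "B * C = 1\<^sub>m n" "C * B = 1\<^sub>m n"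
  shows "invertible_mat B"
  unfolding invertible_mat_def inverts_mat_def using assms by auto

lemma mat_congruent_refl:
  assumes "A \<in> carrier_mat n n" shows "mat_congruent n A A"
  unfolding mat_congruent_def
  by (rule bexI[of _ "1\<^sub>m n"]) (use assms in \<open>auto intro: invertible_matI[of _ n "1\<^sub>m n"]\<close>)

lemma mat_congruent_sym:
  assumes A: "A \<in> carrier_mat n n" and "mat_congruent n A A'"
  shows "mat_congruent n A' A"
proof -
  obtain B where B: "B \<in> carrier_mat n n" "invertible_mat B" and A': "A' = transpose_mat B * A * B"
    using assms unfolding mat_congruent_def by blast
  obtain C where C: "C \<in> carrier_mat n n" "B * C = 1\<^sub>m n" "C * B = 1\<^sub>m n"
    using invertible_matE[OF B(2,1)] .
  have "transpose_mat C * A' * C = transpose_mat C * (transpose_mat B * (A * (B * C)))"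
    unfolding A' using A B(1) C(1) by (simp add: assoc_mult_mat[of _ n n _ n _ n])
  also have "\<dots> = transpose_mat C * transpose_mat B * A"
    unfolding C using A B(1) C(1) by (simp add: assoc_mult_mat[of _ n n _ n _ n])
  also have "transpose_mat C * transpose_mat B = transpose_mat (B * C)"
    by (rule transpose_mult[OF B(1) C(1), symmetric])
  also have "\<dots> * A = A" unfolding C using A by simp
  finally have "A = transpose_mat C * A' * C" ..
  moreover have "invertible_mat C" using B C by (intro invertible_matI[of _ n B]) auto
  ultimately show ?thesis unfolding mat_congruent_def using C by blast
qed

lemma mat_congruent_trans:
  assumes A: "A \<in> carrier_mat n n" and "mat_congruent n A A'" "mat_congruent n A' A''"
  shows "mat_congruent n A A''"
proof -
  obtain B where B: "B \<in> carrier_mat n n" "invertible_mat B" and A': "A' = transpose_mat B * A * B"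
    using assms unfolding mat_congruent_def by blast
  obtain D where D: "D \<in> carrier_mat n n" "invertible_mat D" and A'': "A'' = transpose_mat D * A' * D"
    using assms unfolding mat_congruent_def by blast
  obtain B' where B': "B' \<in> carrier_mat n n" "B * B' = 1\<^sub>m n" "B' * B = 1\<^sub>m n"
    using invertible_matE[OF B(2,1)] .
  obtain D' where D': "D' \<in> carrier_mat n n" "D * D' = 1\<^sub>m n" "D' * D = 1\<^sub>m n"
    using invertible_matE[OF D(2,1)] .
  have "A'' = transpose_mat (B * D) * A * (B * D)"
    unfolding A'' A' using A B(1) D(1)
    by (simp add: transpose_mult[of _ n n] assoc_mult_mat[of _ n n _ n _ n])
  moreover have "invertible_mat (B * D)"
  proof (rule invertible_matI)
    have "B * D * (D' * B') = B * (D * D') * B'"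
      using B(1) D(1) B'(1) D'(1) by (simp add: assoc_mult_mat[of _ n n _ n _ n])
    then show "B * D * (D' * B') = 1\<^sub>m n" using B D B' D' by simp
    have "D' * B' * (B * D) = D' * (B' * B) * D"
      using B(1) D(1) B'(1) D'(1) by (simp add: assoc_mult_mat[of _ n n _ n _ n])
    then show "D' * B' * (B * D) = 1\<^sub>m n" using B D B' D' by simp
  qed (use B D B' D' in auto)
  ultimately show ?thesis unfolding mat_congruent_def using B D by (metis mult_carrier_mat)
qed

lemma index_mult_mat_sum:
  assumes "A \<in> carrier_mat n m" "B \<in> carrier_mat m l" "i < n" "j < l"
  shows "(A * B) $$ (i, j) = (\<Sum>k<m. A $$ (i, k) * B $$ (k, j))"
  using assms by (auto simp: scalar_prod_def lessThan_atLeast0 intro!: sum.cong)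

lemma index_congruence:
  fixes A :: "int mat"
  assumes "A \<in> carrier_mat n n" "B \<in> carrier_mat n n" "i < n" "j < n"
  shows "(transpose_mat B * A * B) $$ (i, j) =
    (\<Sum>l<n. B $$ (l, j) * (\<Sum>k<n. B $$ (k, i) * A $$ (k, l)))"
proof -
  have "(transpose_mat B * A) $$ (i, l) = (\<Sum>k<n. B $$ (k, i) * A $$ (k, l))" if "l < n" for l
    using assms that by (subst index_mult_mat_sum[of _ n n _ n]) auto
  then show ?thesis
    using assms by (subst index_mult_mat_sum[of _ n n _ n]) (auto simp: mult.commute)
qed

text \<open>Reversing an arrow negates one basis vector; the change of basis is a diagonal sign
  matrix, which is its own inverse.\<close>

lemma arrow_gram_flip: "mat_congruent (length (xs @ w # ys)) (arrow_gram (xs @ w # ys)) (arrow_gram (xs @ prod.swap w # ys))"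
proof -
  let ?n = "length (xs @ w # ys)" and ?p = "length xs"
  let ?A = "arrow_gram (xs @ w # ys)" and ?A' = "arrow_gram (xs @ prod.swap w # ys)"
  define e where "e = (\<lambda>i. if i = ?p then - 1 else 1 :: int)"
  define B where "B = mat ?n ?n (\<lambda>(k, i). if k = i then e i else 0)"
  have B: "B \<in> carrier_mat ?n ?n" by (simp add: B_def)
  have col: "(\<Sum>k<?n. B $$ (k, i) * f k) = e i * f i" if "i < ?n" for i f
  proof -
    have "(\<Sum>k<?n. B $$ (k, i) * f k) = (\<Sum>k<?n. if k = i then e i * f i else 0)"
      using that by (intro sum.cong) (auto simp: B_def)
    then show ?thesis using that by simp
  qed
  have BB: "B * B = 1\<^sub>m ?n"
  proof (rule eq_matI)
      fix i j assume ij: "i < dim_row (1\<^sub>m ?n)" "j < dim_col (1\<^sub>m ?n)"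
      then have "(B * B) $$ (i, j) = (\<Sum>k<?n. B $$ (k, j) * B $$ (i, k))"
        using B by (subst index_mult_mat_sum[of _ ?n ?n _ ?n]) (auto simp: mult.commute)
      also have "\<dots> = 1\<^sub>m ?n $$ (i, j)"
        using ij by (subst col) (auto simp: B_def e_def)
      finally show "(B * B) $$ (i, j) = 1\<^sub>m ?n $$ (i, j)" .
  qed (auto simp: B_def)
  have "invertible_mat B" by (rule invertible_matI[OF B B BB BB])
  moreover have "?A' = transpose_mat B * ?A * B"
  proof (rule eq_matI)
    fix i j assume "i < dim_row (transpose_mat B * ?A * B)" "j < dim_col (transpose_mat B * ?A * B)"
    then have ij: "i < ?n" "j < ?n" using B by auto
    have nth: "(xs @ prod.swap w # ys) ! k = (if k = ?p then prod.swap w else (xs @ w # ys) ! k)"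
      "(xs @ w # ys) ! ?p = w" for k
      by (auto simp: nth_append nth_Cons')
    have "(transpose_mat B * ?A * B) $$ (i, j) = e j * (e i * ?A $$ (i, j))"
      using ij by (subst index_congruence[OF _ B]) (simp_all add: col del: length_append)
    also have "\<dots> = ?A' $$ (i, j)"
      using ij nth unfolding e_def arrow_gram_def by (auto simp: arrow_ip_flip)
    finally show "?A' $$ (i, j) = (transpose_mat B * ?A * B) $$ (i, j)" ..
  qed (use B in \<open>auto simp: arrow_gram_def\<close>)
  ultimately show ?thesis unfolding mat_congruent_def using B by blast
qed

text \<open>With \<open>k = arrow_ip u w\<close>, the new basis vectors are \<open>e\<^sub>w\<close>
  and \<open>e\<^sub>u - k e\<^sub>w\<close>, in this order. The entry below the diagonal becomes
  \<open>k - k * 1 = 0\<close> and the diagonal entries stay 1, so the congruence respects the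
  triangular matrix and not only its symmetrisation.\<close>

lemma arrow_gram_braid:
  "mat_congruent (length (xs @ u # w # ys)) (arrow_gram (xs @ u # w # ys)) (arrow_gram (xs @ w # reflect_arrow w u # ys))"
proof -
  let ?n = "length (xs @ u # w # ys)" and ?p = "length xs"
  let ?xs = "xs @ u # w # ys" and ?ys = "xs @ w # reflect_arrow w u # ys"
  let ?A = "arrow_gram ?xs" and ?A' = "arrow_gram ?ys" and ?k = "arrow_ip u w"
  define B where "B = mat ?n ?n (\<lambda>(k, i). if i = ?p then of_bool (k = Suc ?p)
    else if i = Suc ?p then of_bool (k = ?p) - ?k * of_bool (k = Suc ?p) else of_bool (k = i))"
  define C where "C = mat ?n ?n (\<lambda>(k, i). if i = ?p then of_bool (k = Suc ?p) + ?k * of_bool (k = ?p)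
    else if i = Suc ?p then of_bool (k = ?p) else of_bool (k = i))"
  have BC: "B \<in> carrier_mat ?n ?n" "C \<in> carrier_mat ?n ?n" by (simp_all add: B_def C_def)
  have p: "?p < ?n" "Suc ?p < ?n" by simp_all
  have colB: "(\<Sum>k<?n. B $$ (k, i) * f k) =
      (if i = ?p then f (Suc ?p) else if i = Suc ?p then f ?p - ?k * f (Suc ?p) else f i)"
    if "i < ?n" for i f
  proof -
    have "(\<Sum>k<?n. B $$ (k, i) * f k) =
      (\<Sum>k<?n. if i = ?p then (if k = Suc ?p then f k else 0)
        else if i = Suc ?p then (if k = ?p then f k else 0) - ?k * (if k = Suc ?p then f k else 0)
        else (if k = i then f k else 0))"
      using that by (intro sum.cong) (auto simp: B_def algebra_simps)
    then show ?thesis using that p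
      by (simp add: sum_subtractf sum_distrib_left[symmetric] del: length_append split: if_splits)
  qed
  have colC: "(\<Sum>k<?n. C $$ (k, i) * f k) =
      (if i = ?p then f (Suc ?p) + ?k * f ?p else if i = Suc ?p then f ?p else f i)"
    if "i < ?n" for i f
  proof -
    have "(\<Sum>k<?n. C $$ (k, i) * f k) =
      (\<Sum>k<?n. if i = ?p then (if k = Suc ?p then f k else 0) + ?k * (if k = ?p then f k else 0)
        else if i = Suc ?p then (if k = ?p then f k else 0)
        else (if k = i then f k else 0))"
      using that by (intro sum.cong) (auto simp: C_def algebra_simps)
    then show ?thesis using that p
      by (simp add: sum.distrib sum_distrib_left[symmetric] del: length_append split: if_splits)
  qed
  have "invertible_mat B"
  proof (rule invertible_matI[OF BC])
    show "B * C = 1\<^sub>m ?n"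
    proof (rule eq_matI)
      fix i j assume ij: "i < dim_row (1\<^sub>m ?n)" "j < dim_col (1\<^sub>m ?n)"
      then have "(B * C) $$ (i, j) = (\<Sum>k<?n. C $$ (k, j) * B $$ (i, k))"
        using BC by (subst index_mult_mat_sum[of _ ?n ?n _ ?n]) (auto simp: mult.commute)
      also have "\<dots> = 1\<^sub>m ?n $$ (i, j)"
        using ij by (subst colC) (auto simp: B_def)
      finally show "(B * C) $$ (i, j) = 1\<^sub>m ?n $$ (i, j)" .
    qed (auto simp: B_def C_def)
    show "C * B = 1\<^sub>m ?n"
    proof (rule eq_matI)
      fix i j assume ij: "i < dim_row (1\<^sub>m ?n)" "j < dim_col (1\<^sub>m ?n)"
      then have "(C * B) $$ (i, j) = (\<Sum>k<?n. B $$ (k, j) * C $$ (i, k))"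
        using BC by (subst index_mult_mat_sum[of _ ?n ?n _ ?n]) (auto simp: mult.commute)
      also have "\<dots> = 1\<^sub>m ?n $$ (i, j)"
        using ij by (subst colB) (auto simp: C_def)
      finally show "(C * B) $$ (i, j) = 1\<^sub>m ?n $$ (i, j)" .
    qed (auto simp: B_def C_def)
  qed
  moreover have "?A' = transpose_mat B * ?A * B"
  proof (rule eq_matI)
    fix i j assume "i < dim_row (transpose_mat B * ?A * B)" "j < dim_col (transpose_mat B * ?A * B)"
    then have ij: "i < ?n" "j < ?n" using BC by auto
    have nth: "?ys ! k = (if k = ?p then w else if k = Suc ?p then reflect_arrow w u else ?xs ! k)"
      "?xs ! ?p = u" "?xs ! Suc ?p = w" for k
      by (auto simp: nth_append nth_Cons' Suc_diff_le)
    have A: "?A $$ (k, l) = (if k = l then 1 else if k < l then arrow_ip (?xs ! k) (?xs ! l) else 0)"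
      if "k < ?n" "l < ?n" for k l using that by (simp add: arrow_gram_def)
    have A': "?A' $$ (k, l) = (if k = l then 1 else if k < l then arrow_ip (?ys ! k) (?ys ! l) else 0)"
      if "k < ?n" "l < ?n" for k l using that by (simp add: arrow_gram_def)
    let ?r = "\<lambda>l. if i = ?p then ?A $$ (Suc ?p, l)
      else if i = Suc ?p then ?A $$ (?p, l) - ?k * ?A $$ (Suc ?p, l) else ?A $$ (i, l)"
    have "(transpose_mat B * ?A * B) $$ (i, j) = (\<Sum>l<?n. B $$ (l, j) * ?r l)"
      using ij by (subst index_congruence[OF _ BC(1)]) (simp_all add: colB del: length_append)
    also have "\<dots> = (if j = ?p then ?r (Suc ?p) else if j = Suc ?p then ?r ?p - ?k * ?r (Suc ?p) else ?r j)"
      by (rule colB[OF ij(2)])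
    also have "\<dots> = ?A' $$ (i, j)"
    proof -
      have reflect_arrow: "arrow_ip (reflect_arrow w u) z = arrow_ip u z - ?k * arrow_ip w z" for z
        by (metis arrow_ip_reflect arrow_ip_commute)
      \<comment> \<open>The entry above the diagonal needs \<open>k - k * 2 = - k\<close>. Loops are
        not excluded here; their incidence vector is zero, and then \<open>?k\<close> vanishes
        too.\<close>
      have self: "arrow_ip w w = 2 \<or> ?k = 0" by (auto simp: arrow_ip_def incidence_def)
      show ?thesis
        unfolding A'[OF ij] nth(1)
        using ij p nth(2,3) self
        by (cases "i = ?p"; cases "i = Suc ?p"; cases "j = ?p"; cases "j = Suc ?p")
          (auto simp: A reflect_arrow arrow_ip_reflect arrow_ip_commute[of w u] simp del: length_append)
    qed
    finally show "?A' $$ (i, j) = (transpose_mat B * ?A * B) $$ (i, j)" ..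
  qed (use BC in \<open>auto simp: arrow_gram_def\<close>)
  ultimately show ?thesis unfolding mat_congruent_def using BC by blast
qed

lemma hurwitz_eq_congruent: "xs \<approx> ys \<Longrightarrow> mat_congruent (length xs) (arrow_gram xs) (arrow_gram ys)"
proof (induction rule: hurwitz_eq.induct)
  case (hurwitz_refl xs)
  show ?case by (rule mat_congruent_refl) simp
next
  case (hurwitz_sym xs ys)
  then show ?case using mat_congruent_sym hurwitz_eq_length arrow_gram_carrier by metis
next
  case (hurwitz_trans xs ys zs)
  then show ?case using mat_congruent_trans hurwitz_eq_length arrow_gram_carrier by metis
next
  case (hurwitz_flip xs s t ys)
  show ?case using arrow_gram_flip[of xs "(s, t)" ys] by simp
next
  case (hurwitz_braid xs u w ys)
  show ?case by (rule arrow_gram_braid)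
qed

lemma arrow_gram_relabel:
  assumes "inj_on \<sigma> V" "arrows_on V xs"
  shows "arrow_gram (map (map_prod \<sigma> \<sigma>) xs) = arrow_gram xs"
proof -
  have "arrow_ip (map_prod \<sigma> \<sigma> (xs ! i)) (map_prod \<sigma> \<sigma> (xs ! j)) = arrow_ip (xs ! i) (xs ! j)"
    if "i < length xs" "j < length xs" for i j
  proof -
    have "fst (xs ! i) \<in> V" "snd (xs ! i) \<in> V" "fst (xs ! j) \<in> V" "snd (xs ! j) \<in> V"
      using assms(2) nth_mem that unfolding arrows_on_def by fastforce+
    then show ?thesis
      using assms(1) by (simp add: arrow_ip_def incidence_def inj_on_eq_iff)
  qed
  then show ?thesis by (intro eq_matI) (auto simp: arrow_gram_def)
qed

lemma monodromy_relabel: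
  assumes "bij \<sigma>"
  shows "monodromy (map (map_prod \<sigma> \<sigma>) xs) (\<sigma> v) = \<sigma> (monodromy xs v)"
proof (induction xs arbitrary: v)
  case (Cons w xs)
  have "arrow_swap (map_prod \<sigma> \<sigma> w) (\<sigma> v) = \<sigma> (arrow_swap w v)"
    using bij_is_inj[OF assms] by (cases w) (auto simp: arrow_swap_def Transposition.transpose_def inj_eq)
  then show ?case using Cons by simp
qed simp

section \<open>The upper Gram matrix of a form given by arrows\<close>

lemma upper_gram_eqI:
  assumes M: "M \<in> carrier_mat n n" "upper_triangular M"
    and q: "\<And>x. x \<in> carrier_vec n \<Longrightarrow> q x = x \<bullet> (M *\<^sub>v x)"
  shows "upper_gram n q = M"
proof -
  have "q x = (\<Sum>j<n. \<Sum>i\<le>j. M $$ (i, j) * x $ i * x $ j)" if x: "x \<in> carrier_vec n" for x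
  proof -
    have "q x = (\<Sum>j<n. \<Sum>i<n. M $$ (i, j) * x $ i * x $ j)"
      unfolding q[OF x] by (subst sum.swap) (rule scalar_prod_mult_mat_vec[OF M(1) x])
    also have "\<dots> = (\<Sum>j<n. \<Sum>i\<le>j. M $$ (i, j) * x $ i * x $ j)"
    proof (rule sum.cong[OF refl])
      fix j assume "j \<in> {..<n}"
      then show "(\<Sum>i<n. M $$ (i, j) * x $ i * x $ j) = (\<Sum>i\<le>j. M $$ (i, j) * x $ i * x $ j)"
        using M by (intro sum.mono_neutral_cong_right) (auto simp: upper_triangular_def)
    qed
    finally show ?thesis .
  qed
  then have "integral_quadratic_form n q"
    unfolding integral_quadratic_form_def by (intro exI[of _ "\<lambda>i j. M $$ (i, j)"]) simp
  from ex1_upper_gram[OF this] show ?thesis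
    unfolding upper_gram_def by (rule the1_equality) (use M q in auto)
qed

lemma sum_incidence:
  assumes "finite V" "arrows_on V [w]"
  shows "(\<Sum>v\<in>V. f v * incidence w v) = f (fst w) - f (snd w)"
proof -
  have "(\<Sum>v\<in>V. f v * incidence w v) =
      (\<Sum>v\<in>V. (if fst w = v then f v else 0) - (if snd w = v then f v else 0))"
    by (intro sum.cong) (auto simp: incidence_def)
  then show ?thesis
    using assms by (auto simp: sum_subtractf arrows_on_def)
qed

text \<open>Expanding the squares yields the Gram matrix of the incidence vectors. For
  \<open>A = arrow_gram xs\<close> it is \<open>A + A\<^sup>T\<close>, as an arrow with distinct
  ends has norm 2, and both summands give the same quadratic form.\<close>

lemma upper_gram_arrows:
  assumes V: "finite V" and xs: "arrows_on V xs" "length xs = n"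
    and q: "\<And>x. x \<in> carrier_vec n \<Longrightarrow> 2 * q x = (\<Sum>v\<in>V. (\<Sum>i<n. x $ i * incidence (xs ! i) v)\<^sup>2)"
  shows "upper_gram n q = arrow_gram xs"
proof (rule upper_gram_eqI)
  show M: "arrow_gram xs \<in> carrier_mat n n" using xs by auto
  show "upper_triangular (arrow_gram xs)" by (auto simp: arrow_gram_def)
  fix x :: "int vec" assume x: "x \<in> carrier_vec n"
  let ?M = "\<lambda>i j. arrow_gram xs $$ (i, j)"
  have on: "arrows_on V [xs ! i]" if "i < n" for i
    using xs that by (auto simp: arrows_on_def)
  have arrow_ip: "(\<Sum>v\<in>V. incidence (xs ! i) v * incidence (xs ! j) v) = ?M i j + ?M j i"
    if ij: "i < n" "j < n" for i j
  proof -
    have "(\<Sum>v\<in>V. incidence (xs ! i) v * incidence (xs ! j) v) = arrow_ip (xs ! i) (xs ! j)"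
      unfolding arrow_ip_def by (rule sum_incidence[OF V on[OF ij(2)]])
    moreover have "arrow_ip (xs ! i) (xs ! i) = 2"
      using on[OF ij(1)] by (auto simp: arrow_ip_def incidence_def arrows_on_def split: prod.splits)
    ultimately show ?thesis
      using ij xs arrow_ip_commute[of "xs ! i" "xs ! j"]
      by (cases i j rule: linorder_cases) (simp_all add: arrow_gram_def)
  qed
  have "2 * q x = (\<Sum>v\<in>V. \<Sum>i<n. \<Sum>j<n. x $ i * x $ j * (incidence (xs ! i) v * incidence (xs ! j) v))"
    unfolding q[OF x] power2_eq_square sum_product by (intro sum.cong) (auto simp: algebra_simps)
  also have "\<dots> = (\<Sum>i<n. \<Sum>j<n. \<Sum>v\<in>V. x $ i * x $ j * (incidence (xs ! i) v * incidence (xs ! j) v))"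
    by (subst sum.swap, subst (2) sum.swap) simp
  also have "\<dots> = (\<Sum>i<n. \<Sum>j<n. x $ i * x $ j * (?M i j + ?M j i))"
    unfolding sum_distrib_left[symmetric] using arrow_ip by (intro sum.cong) auto
  also have "\<dots> = (\<Sum>i<n. \<Sum>j<n. ?M i j * x $ i * x $ j) + (\<Sum>i<n. \<Sum>j<n. ?M j i * x $ j * x $ i)"
    unfolding sum.distrib[symmetric] by (intro sum.cong) (auto simp: algebra_simps)
  also have "(\<Sum>i<n. \<Sum>j<n. ?M j i * x $ j * x $ i) = (\<Sum>i<n. \<Sum>j<n. ?M i j * x $ i * x $ j)"
    by (rule sum.swap)
  finally show "q x = x \<bullet> (arrow_gram xs *\<^sub>v x)"
    using scalar_prod_mult_mat_vec[OF M x] by simp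
qed

section \<open>The trace of the Coxeter transformation\<close>

definition mtrace :: "int mat \<Rightarrow> int" where
  "mtrace A = (\<Sum>i<dim_row A. A $$ (i, i))"

lemma mtrace_mult_comm:
  assumes "A \<in> carrier_mat n m" "B \<in> carrier_mat m n"
  shows "mtrace (A * B) = mtrace (B * A)"
proof -
  have "mtrace (A * B) = (\<Sum>i<n. \<Sum>k<m. A $$ (i, k) * B $$ (k, i))"
    using assms by (auto simp: mtrace_def index_mult_mat_sum[OF assms] simp del: index_mult_mat(1))
  also have "\<dots> = (\<Sum>k<m. \<Sum>i<n. B $$ (k, i) * A $$ (i, k))"
    by (subst sum.swap) (simp add: mult.commute)
  also have "\<dots> = mtrace (B * A)"
    using assms by (auto simp: mtrace_def index_mult_mat_sum[OF assms(2,1)] simp del: index_mult_mat(1))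
  finally show ?thesis .
qed

lemma mtrace_one_minus:
  "A \<in> carrier_mat n n \<Longrightarrow> mtrace (1\<^sub>m n - A) = int n - mtrace A"
  by (auto simp: mtrace_def sum_subtractf)

lemma one_minus_mult_one_minus:
  fixes U W :: "int mat"
  assumes U: "U \<in> carrier_mat n n" and W: "W \<in> carrier_mat n n"
  shows "(1\<^sub>m n - U) * (1\<^sub>m n - W) = 1\<^sub>m n - W - (U - U * W)"
proof -
  have c: "1\<^sub>m n - W \<in> carrier_mat n n" using W by (rule minus_carrier_mat)
  show ?thesis
    unfolding minus_mult_distrib_mat[OF one_carrier_mat U c] left_mult_one_mat[OF c]
      mult_minus_distrib_mat[OF U one_carrier_mat W] right_mult_one_mat[OF U] ..
qed

text \<open>Both powers are governed by one polynomial \<open>S\<close> in \<open>Y * X\<close>: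
  they are \<open>1 - X S Y\<close> and \<open>1 - Y X S\<close>. Cyclicity of the trace then leaves
  only the traces of the two identity matrices.\<close>

lemma mtrace_pow_one_minus_comm:
  fixes X Y :: "int mat"
  assumes X: "X \<in> carrier_mat n m" and Y: "Y \<in> carrier_mat m n"
  shows "mtrace ((1\<^sub>m n - X * Y) ^\<^sub>m k) - int n = mtrace ((1\<^sub>m m - Y * X) ^\<^sub>m k) - int m"
proof -
  have "\<exists>S \<in> carrier_mat m m. (1\<^sub>m n - X * Y) ^\<^sub>m k = 1\<^sub>m n - X * (S * Y) \<and>
      (1\<^sub>m m - Y * X) ^\<^sub>m k = 1\<^sub>m m - Y * X * S"
  proof (induction k)
    case 0
    have "(1\<^sub>m n - X * Y) ^\<^sub>m 0 = 1\<^sub>m n - X * (0\<^sub>m m m * Y)"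
      "(1\<^sub>m m - Y * X) ^\<^sub>m 0 = 1\<^sub>m m - Y * X * 0\<^sub>m m m"
      using X Y by (auto intro!: eq_matI)
    then show ?case by (intro bexI[of _ "0\<^sub>m m m"]) auto
  next
    case (Suc k)
    then obtain S where S: "S \<in> carrier_mat m m"
      "(1\<^sub>m n - X * Y) ^\<^sub>m k = 1\<^sub>m n - X * (S * Y)"
      "(1\<^sub>m m - Y * X) ^\<^sub>m k = 1\<^sub>m m - Y * X * S" by blast
    \<comment> \<open>Multiplying \<open>1 - X S Y\<close> by \<open>1 - X Y\<close> dictates this
      recursion, and the other side obeys the same one.\<close>
    let ?S = "S + (1\<^sub>m m - S * (Y * X))"
    have c: "X * Y \<in> carrier_mat n n" "Y * X \<in> carrier_mat m m" "S * Y \<in> carrier_mat m n"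
      "X * (S * Y) \<in> carrier_mat n n" "Y * X * S \<in> carrier_mat m m" "S * (Y * X) \<in> carrier_mat m m"
      using X Y S(1) by auto
    have "(1\<^sub>m n - X * Y) ^\<^sub>m Suc k = 1\<^sub>m n - X * Y - (X * (S * Y) - X * (S * Y) * (X * Y))"
      using S(2) c by (simp add: one_minus_mult_one_minus)
    also have "X * (S * Y) * (X * Y) = X * (S * (Y * X) * Y)"
      using X Y S(1) by (simp add: assoc_mult_mat[of _ n m _ n _ n] assoc_mult_mat[of _ m m _ n _ n]
        assoc_mult_mat[of _ m m _ m _ n] assoc_mult_mat[of _ m n _ m _ n])
    also have "1\<^sub>m n - X * Y - (X * (S * Y) - X * (S * (Y * X) * Y)) =
        1\<^sub>m n - (X * (S * Y) + (X * Y - X * (S * (Y * X) * Y)))"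
      using X Y S(1) by (intro eq_matI) auto
    also have "X * (S * Y) + (X * Y - X * (S * (Y * X) * Y)) = X * (?S * Y)"
    proof -
      have d: "S * (Y * X) * Y \<in> carrier_mat m n" "1\<^sub>m m - S * (Y * X) \<in> carrier_mat m m"
        "Y - S * (Y * X) * Y \<in> carrier_mat m n"
        using Y c by (auto intro!: minus_carrier_mat)
      show ?thesis
        unfolding add_mult_distrib_mat[OF S(1) d(2) Y] minus_mult_distrib_mat[OF one_carrier_mat c(6) Y]
          left_mult_one_mat[OF Y] mult_add_distrib_mat[OF X c(3) d(3)]
          mult_minus_distrib_mat[OF X Y d(1)] ..
    qed
    finally have 1: "(1\<^sub>m n - X * Y) ^\<^sub>m Suc k = 1\<^sub>m n - X * (?S * Y)" .
    have "(1\<^sub>m m - Y * X) ^\<^sub>m Suc k = 1\<^sub>m m - Y * X - (Y * X * S - Y * X * S * (Y * X))"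
      using S(3) c by (simp add: one_minus_mult_one_minus)
    also have "Y * X * S * (Y * X) = Y * X * (S * (Y * X))"
      using c S(1) by (simp add: assoc_mult_mat[of _ m m _ m _ m])
    also have "1\<^sub>m m - Y * X - (Y * X * S - Y * X * (S * (Y * X))) =
        1\<^sub>m m - (Y * X * S + (Y * X - Y * X * (S * (Y * X))))"
      using X Y S(1) by (intro eq_matI) auto
    also have "Y * X * S + (Y * X - Y * X * (S * (Y * X))) = Y * X * ?S"
    proof -
      have d: "1\<^sub>m m - S * (Y * X) \<in> carrier_mat m m" using c by (intro minus_carrier_mat)
      show ?thesis
        unfolding mult_add_distrib_mat[OF c(2) S(1) d] mult_minus_distrib_mat[OF c(2) one_carrier_mat c(6)]
          right_mult_one_mat[OF c(2)] ..
    qed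
    finally have 2: "(1\<^sub>m m - Y * X) ^\<^sub>m Suc k = 1\<^sub>m m - Y * X * ?S" .
    have "?S \<in> carrier_mat m m" by (rule add_carrier_mat[OF minus_carrier_mat[OF c(6)]])
    with 1 2 show ?case by (intro bexI[of _ ?S] conjI)
  qed
  then obtain S where S: "S \<in> carrier_mat m m"
    "(1\<^sub>m n - X * Y) ^\<^sub>m k = 1\<^sub>m n - X * (S * Y)"
    "(1\<^sub>m m - Y * X) ^\<^sub>m k = 1\<^sub>m m - Y * X * S" by blast
  have "mtrace (X * (S * Y)) = mtrace (S * Y * X)"
    by (rule mtrace_mult_comm[OF X mult_carrier_mat[OF S(1) Y]])
  also have "S * Y * X = S * (Y * X)"
    by (rule assoc_mult_mat[OF S(1) Y X])
  also have "mtrace \<dots> = mtrace (Y * X * S)"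
    by (rule mtrace_mult_comm[OF S(1) mult_carrier_mat[OF Y X]])
  finally show ?thesis
    unfolding S(2,3) using mtrace_one_minus[of "X * (S * Y)" n] mtrace_one_minus[of "Y * X * S" m]
      X Y S(1) by (simp del: index_mult_mat)
qed

text \<open>The matrix \<open>1 - A\<inverse> (A + A\<^sup>T) = - A\<inverse> A\<^sup>T\<close> is the Coxeter transformation of \<open>A\<close>; a congruence
  of \<open>A\<close> turns it into a similar matrix.\<close>

lemma mat_congruent_mtrace_coxeter:
  assumes A: "A \<in> carrier_mat n n" and N: "N \<in> carrier_mat n n" "A * N = 1\<^sub>m n"
    and cong: "mat_congruent n A A'"
    and N': "N' \<in> carrier_mat n n" "N' * A' = 1\<^sub>m n"
  shows "mtrace ((1\<^sub>m n - N' * (A' + transpose_mat A')) ^\<^sub>m k) =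
    mtrace ((1\<^sub>m n - N * (A + transpose_mat A)) ^\<^sub>m k)"
proof -
  note assoc = assoc_mult_mat[of _ n n _ n _ n]
  obtain B where B: "B \<in> carrier_mat n n" "invertible_mat B" and A': "A' = transpose_mat B * A * B"
    using cong unfolding mat_congruent_def by blast
  obtain C where C: "C \<in> carrier_mat n n" "B * C = 1\<^sub>m n" "C * B = 1\<^sub>m n"
    using invertible_matE[OF B(2,1)] .
  define G where "G = A + transpose_mat A"
  have G: "G \<in> carrier_mat n n" using A by (simp add: G_def)
  have BT: "transpose_mat B \<in> carrier_mat n n" and A'c: "A' \<in> carrier_mat n n"
    using A B(1) by (simp_all add: A')
  have "A' + transpose_mat A' = transpose_mat B * G * B"
    using A B(1) unfolding A' G_def
    by (simp add: transpose_mult[of _ n n _ n] add_mult_distrib_mat[of _ n n] mult_add_distrib_mat[of _ n n _ n] assoc)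
  \<comment> \<open>With a right inverse of \<open>A\<close> and a left inverse of \<open>A'\<close>
    at hand, \<open>A * N\<close> is inserted on the right until \<open>N' * A'\<close> appears and
    cancels.\<close>
  moreover have "N' * (transpose_mat B) = C * N"
  proof -
    have "N' * (transpose_mat B) = N' * (transpose_mat B * (A * ((B * C) * N)))"
      unfolding C using N A B(1) by simp
    also have "\<dots> = N' * A' * (C * N)"
      unfolding A' using N(1) N'(1) A B(1) C(1) by (simp add: assoc)
    finally show ?thesis using N' C N by simp
  qed
  moreover have "N' * (transpose_mat B * G * B) = N' * transpose_mat B * G * B"
    using N'(1) BT B(1) G by (simp add: assoc)
  ultimately have "N' * (A' + transpose_mat A') = C * N * G * B" by simp
  also have "\<dots> = C * (N * G) * B"
    using N(1) C(1) B(1) G by (simp add: assoc)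
  finally have cox: "N' * (A' + transpose_mat A') = C * (N * G) * B" .
  define \<Phi> where "\<Phi> = 1\<^sub>m n - N * G"
  define \<Psi> where "\<Psi> = 1\<^sub>m n - N' * (A' + transpose_mat A')"
  have \<Phi>: "\<Phi> \<in> carrier_mat n n" unfolding \<Phi>_def using N G by (intro minus_carrier_mat mult_carrier_mat)
  have "\<Psi> = C * \<Phi> * B"
  proof -
    have c: "N * G \<in> carrier_mat n n" "C * (N * G) \<in> carrier_mat n n" using N G C by auto
    have "C * \<Phi> = C - C * (N * G)"
      unfolding \<Phi>_def using mult_minus_distrib_mat[OF C(1) one_carrier_mat c(1)] C(1) by simp
    then have "C * \<Phi> * B = C * B - C * (N * G) * B"
      using minus_mult_distrib_mat[OF C(1) c(2) B(1)] by simp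
    then show ?thesis unfolding \<Psi>_def cox C ..
  qed
  have pow: "\<Psi> ^\<^sub>m k = C * (\<Phi> ^\<^sub>m k * B)"
  proof (induction k)
    case 0
    then show ?case using C B \<Phi> \<open>\<Psi> = C * \<Phi> * B\<close> by auto
  next
    case (Suc k)
    define F where "F = \<Phi> ^\<^sub>m k"
    have F: "F \<in> carrier_mat n n" using \<Phi> by (simp add: F_def)
    have "\<Psi> ^\<^sub>m Suc k = C * (F * B) * (C * \<Phi> * B)"
      using \<open>\<Psi> = C * \<Phi> * B\<close> Suc by (simp add: F_def)
    also have "\<dots> = C * (F * ((B * C) * (\<Phi> * B)))"
      using F \<Phi> C(1) B(1) by (simp add: assoc)
    also have "\<dots> = C * (F * \<Phi> * B)"
      unfolding C using F \<Phi> C(1) B(1) by (simp add: assoc)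
    finally show ?case by (simp add: F_def)
  qed
  have P: "\<Phi> ^\<^sub>m k \<in> carrier_mat n n" using \<Phi> by simp
  have "mtrace (\<Psi> ^\<^sub>m k) = mtrace (\<Phi> ^\<^sub>m k * B * C)"
    unfolding pow using P B(1) C(1) by (intro mtrace_mult_comm[of _ n n]) auto
  also have "\<Phi> ^\<^sub>m k * B * C = \<Phi> ^\<^sub>m k * (B * C)"
    by (rule assoc_mult_mat[OF P B(1) C(1)])
  also have "\<dots> = \<Phi> ^\<^sub>m k" unfolding C by (rule right_mult_one_mat[OF P])
  finally show ?thesis by (simp add: \<Phi>_def \<Psi>_def G_def)
qed

text \<open>A triangular matrix with unit diagonal has determinant 1, so its adjugate is an integral
  inverse.\<close>

lemma arrow_gram_inverse:
  obtains N where "N \<in> carrier_mat (length xs) (length xs)"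
    "arrow_gram xs * N = 1\<^sub>m (length xs)" "N * arrow_gram xs = 1\<^sub>m (length xs)"
proof -
  let ?A = "arrow_gram xs" and ?n = "length xs"
  have "det ?A = prod_list (diag_mat ?A)"
    by (rule det_upper_triangular[of _ ?n]) (auto simp: arrow_gram_def)
  also have "diag_mat ?A = map (\<lambda>_. 1) [0..<?n]"
    by (auto simp: diag_mat_def arrow_gram_def)
  also have "prod_list \<dots> = 1" by (simp add: map_replicate_const)
  finally have "det ?A = 1" .
  with adj_mat[OF arrow_gram_carrier[of xs]] show thesis
    by (intro that[of "adj_mat ?A"]) auto
qed

text \<open>Solving the triangular system \<open>A x = (z(s\<^sub>i) - z(t\<^sub>i))\<^sub>i\<close> by back substitution applies
  the reflections of the arrows to \<open>z\<close> one after the other.\<close>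

lemma apply_monodromy:
  fixes x :: "nat \<Rightarrow> int" and z :: "'a \<Rightarrow> int"
  assumes "\<And>i. i < length xs \<Longrightarrow> x i + (\<Sum>j\<in>{i<..<length xs}. arrow_ip (xs ! i) (xs ! j) * x j) =
    z (fst (xs ! i)) - z (snd (xs ! i))"
  shows "z (monodromy xs v) = z v - (\<Sum>i<length xs. x i * incidence (xs ! i) v)"
  using assms
proof (induction xs arbitrary: x v)
  case (Cons u xs)
  let ?y = "\<lambda>v. z (monodromy xs v)" and ?n = "length xs"
  have y: "?y v = z v - (\<Sum>i<?n. x (Suc i) * incidence (xs ! i) v)" for v
  proof (rule Cons.IH)
    fix i assume "i < ?n"
    have "(\<Sum>j\<in>{Suc i<..<Suc ?n}. arrow_ip (xs ! i) ((u # xs) ! j) * x j) =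
        (\<Sum>j\<in>{i<..<?n}. arrow_ip (xs ! i) (xs ! j) * x (Suc j))"
      by (rule sum.reindex_bij_witness[of _ Suc "\<lambda>j. j - 1"]) auto
    then show "x (Suc i) + (\<Sum>j\<in>{i<..<?n}. arrow_ip (xs ! i) (xs ! j) * x (Suc j)) =
      z (fst (xs ! i)) - z (snd (xs ! i))"
      using Cons.prems[of "Suc i"] \<open>i < ?n\<close> by simp
  qed
  have "(\<Sum>j\<in>{0<..<Suc ?n}. arrow_ip u ((u # xs) ! j) * x j) = (\<Sum>j<?n. arrow_ip u (xs ! j) * x (Suc j))"
    by (rule sum.reindex_bij_witness[of _ Suc "\<lambda>j. j - 1"]) auto
  then have x0: "x 0 = z (fst u) - z (snd u) - (\<Sum>j<?n. arrow_ip u (xs ! j) * x (Suc j))"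
    using Cons.prems[of 0] by simp
  \<comment> \<open>The coordinate of the first arrow is its pairing with \<open>z\<close> already
    transformed by the later arrows, which is the coefficient in the reflection at
    \<open>u\<close>.\<close>
  have "?y (fst u) - ?y (snd u) = x 0"
    unfolding y x0 arrow_ip_commute[of u] by (simp add: arrow_ip_def algebra_simps sum_subtractf)
  then have "z (monodromy (u # xs) v) = ?y v - incidence u v * x 0"
    using apply_arrow_swap[of ?y u v] by simp
  then show ?case
    unfolding y by (simp add: sum.lessThan_Suc_shift del: sum.lessThan_Suc)
qed simp

lemma funpow_permutes_mem: "c permutes V \<Longrightarrow> v \<in> V \<Longrightarrow> (c ^^ k) v \<in> V"
  by (induction k) (auto simp: permutes_in_image)

text \<open>With the incidence matrix \<open>Y\<close> and \<open>X = A\<inverse> Y\<^sup>T\<close>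
  the Coxeter matrix is \<open>1 - X Y\<close>. Passing to \<open>1 - Y X\<close> moves from arrows
  to vertices, where the matrix is the permutation matrix of the product and the trace of a power
  counts fixed points.\<close>

lemma mtrace_coxeter_arrow_gram:
  fixes xs :: "(nat \<times> nat) list"
  defines "n \<equiv> length xs"
  assumes on: "arrows_on {1..m} xs"
    and N: "N \<in> carrier_mat n n" "arrow_gram xs * N = 1\<^sub>m n"
  shows "mtrace ((1\<^sub>m n - N * (arrow_gram xs + transpose_mat (arrow_gram xs))) ^\<^sub>m k) - int n =
    int (card {v \<in> {1..m}. (monodromy xs ^^ k) v = v}) - int m"
proof -
  let ?c = "monodromy xs"
  define Y where "Y = mat m n (\<lambda>(v, i). incidence (xs ! i) (v + 1))"
  define X where "X = N * transpose_mat Y"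
  have A: "arrow_gram xs \<in> carrier_mat n n" by (simp add: n_def)
  have Y: "Y \<in> carrier_mat m n" by (simp add: Y_def)
  have X: "X \<in> carrier_mat n m" using N Y by (simp add: X_def)
  have bij: "bij_betw Suc {..<m} {1..m}"
    by (rule bij_betw_byWitness[of _ "\<lambda>v. v - 1"]) auto
  have perm: "?c permutes {1..m}" using monodromy_permutes[OF on] .
  have gram: "arrow_gram xs + transpose_mat (arrow_gram xs) = transpose_mat Y * Y"
  proof (rule eq_matI)
    fix i j assume "i < dim_row (transpose_mat Y * Y)" "j < dim_col (transpose_mat Y * Y)"
    then have ij: "i < n" "j < n" using Y by auto
    have on': "arrows_on {1..m} [xs ! i]" if "i < n" for i
      using on that by (auto simp: arrows_on_def n_def)
    have "(transpose_mat Y * Y) $$ (i, j) = (\<Sum>v<m. incidence (xs ! i) (Suc v) * incidence (xs ! j) (Suc v))"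
      using ij Y by (subst index_mult_mat_sum[of _ n m _ n]) (auto simp: Y_def)
    also have "\<dots> = (\<Sum>v\<in>{1..m}. incidence (xs ! i) v * incidence (xs ! j) v)"
      by (rule sum.reindex_bij_betw[OF bij])
    also have "\<dots> = arrow_ip (xs ! i) (xs ! j)"
      unfolding arrow_ip_def by (rule sum_incidence[OF _ on'[OF ij(2)]]) simp
    also have "\<dots> = (arrow_gram xs + transpose_mat (arrow_gram xs)) $$ (i, j)"
    proof -
      have "arrow_ip (xs ! i) (xs ! i) = 2"
        using on'[OF ij(1)] by (auto simp: arrow_ip_def incidence_def arrows_on_def split: prod.splits)
      then show ?thesis
        using ij arrow_ip_commute[of "xs ! i" "xs ! j"]
        by (cases i j rule: linorder_cases) (simp_all add: arrow_gram_def n_def)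
    qed
    finally show "(arrow_gram xs + transpose_mat (arrow_gram xs)) $$ (i, j) = (transpose_mat Y * Y) $$ (i, j)" ..
  qed (use A Y in auto)
  have AX: "arrow_gram xs * X = transpose_mat Y"
    unfolding X_def using A N Y by (simp add: assoc_mult_mat[of _ n n _ n _ m, symmetric])
  define P where "P = (\<lambda>k. mat m m (\<lambda>(v, w). of_bool ((?c ^^ k) (v + 1) = w + 1) :: int))"
  have YX: "1\<^sub>m m - Y * X = P 1"
  proof (rule eq_matI)
    fix v w assume "v < dim_row (P 1)" "w < dim_col (P 1)"
    then have vw: "v < m" "w < m" by (auto simp: P_def)
    \<comment> \<open>Column \<open>w\<close> of \<open>X\<close> solves the triangular system whose
      right-hand side comes from the indicator function of the vertex \<open>w + 1\<close>; rows and
      columns start at 0, vertices at 1.\<close>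
    define z where "z = (\<lambda>u. of_bool (u = w + 1) :: int)"
    have "z (?c (v + 1)) = z (v + 1) - (\<Sum>i<length xs. X $$ (i, w) * incidence (xs ! i) (v + 1))"
    proof (rule apply_monodromy)
      fix i assume i: "i < length xs"
      have "incidence (xs ! i) (w + 1) = (arrow_gram xs * X) $$ (i, w)"
        unfolding AX using i vw by (simp add: Y_def n_def)
      also have "\<dots> = (\<Sum>j<n. arrow_gram xs $$ (i, j) * X $$ (j, w))"
        using A X i vw by (intro index_mult_mat_sum) (auto simp: n_def)
      also have "\<dots> = (\<Sum>j\<in>{i..<n}. arrow_gram xs $$ (i, j) * X $$ (j, w))"
        using i by (intro sum.mono_neutral_right) (auto simp: arrow_gram_def n_def)
      also have "\<dots> = X $$ (i, w) + (\<Sum>j\<in>{i<..<n}. arrow_gram xs $$ (i, j) * X $$ (j, w))"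
      proof -
        have "{i..<n} = insert i {i<..<n}" using i by (auto simp: n_def)
        then show ?thesis using i by (simp add: arrow_gram_def n_def)
      qed
      also have "(\<Sum>j\<in>{i<..<n}. arrow_gram xs $$ (i, j) * X $$ (j, w)) =
          (\<Sum>j\<in>{i<..<n}. arrow_ip (xs ! i) (xs ! j) * X $$ (j, w))"
        using i by (intro sum.cong) (auto simp: arrow_gram_def n_def)
      finally show "X $$ (i, w) + (\<Sum>j\<in>{i<..<length xs}. arrow_ip (xs ! i) (xs ! j) * X $$ (j, w)) =
          z (fst (xs ! i)) - z (snd (xs ! i))"
        by (simp add: z_def incidence_def n_def)
    qed
    moreover have "(Y * X) $$ (v, w) = (\<Sum>i<n. X $$ (i, w) * incidence (xs ! i) (v + 1))"
      using vw by (subst index_mult_mat_sum[OF Y X]) (auto simp: Y_def mult.commute)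
    ultimately show "(1\<^sub>m m - Y * X) $$ (v, w) = P 1 $$ (v, w)"
      using vw Y X by (simp add: P_def z_def n_def del: index_mult_mat(1))
  qed (use X Y in \<open>auto simp: P_def\<close>)
  have pow: "P 1 ^\<^sub>m k = P k"
  proof (induction k)
    case 0
    show ?case by (rule eq_matI) (auto simp: P_def)
  next
    case (Suc k)
    have "P k * P 1 = P (Suc k)"
    proof (rule eq_matI)
      fix v w assume "v < dim_row (P (Suc k))" "w < dim_col (P (Suc k))"
      then have vw: "v < m" "w < m" by (auto simp: P_def)
      have "(P k * P 1) $$ (v, w) = (\<Sum>u<m. P k $$ (v, u) * P 1 $$ (u, w))"
        using vw by (intro index_mult_mat_sum) (auto simp: P_def)
      also have "\<dots> = (\<Sum>u<m. of_bool ((?c ^^ k) (v + 1) = Suc u) * of_bool (?c (Suc u) = w + 1))"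
        using vw by (intro sum.cong) (auto simp: P_def)
      also have "\<dots> = (\<Sum>u\<in>{1..m}. of_bool ((?c ^^ k) (v + 1) = u) * of_bool (?c u = w + 1))"
        by (rule sum.reindex_bij_betw[OF bij])
      also have "\<dots> = (\<Sum>u\<in>{1..m}. if u = (?c ^^ k) (v + 1) then of_bool (?c u = w + 1) else 0)"
        by (intro sum.cong) auto
      also have "\<dots> = of_bool (?c ((?c ^^ k) (v + 1)) = w + 1)"
        using funpow_permutes_mem[OF perm, of "v + 1" k] vw by simp
      finally show "(P k * P 1) $$ (v, w) = P (Suc k) $$ (v, w)"
        using vw by (simp add: P_def)
    qed (auto simp: P_def)
    then show ?case using Suc by simp
  qed
  have "mtrace (P k) = (\<Sum>v<m. of_bool ((?c ^^ k) (Suc v) = Suc v))"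
    by (simp add: mtrace_def P_def)
  also have "\<dots> = (\<Sum>v\<in>{1..m}. of_bool ((?c ^^ k) v = v))"
    by (rule sum.reindex_bij_betw[OF bij])
  also have "\<dots> = int (card {v \<in> {1..m}. (?c ^^ k) v = v})"
    by (simp add: sum.If_cases of_bool_def Int_def conj_commute)
  finally have tr: "mtrace (P k) = int (card {v \<in> {1..m}. (?c ^^ k) v = v})" .
  have "N * (arrow_gram xs + transpose_mat (arrow_gram xs)) = X * Y"
    unfolding gram X_def using N Y by (simp add: assoc_mult_mat[of _ n n _ m _ n])
  then show ?thesis
    using mtrace_pow_one_minus_comm[OF X Y, of k] YX pow tr by simp
qed

lemma card_fixed_congruent:
  fixes xs ys :: "(nat \<times> nat) list"
  assumes "arrows_on {1..m} xs" "arrows_on {1..m} ys" "length xs = length ys"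
    "mat_congruent (length xs) (arrow_gram xs) (arrow_gram ys)"
  shows "card {v \<in> {1..m}. (monodromy xs ^^ k) v = v} = card {v \<in> {1..m}. (monodromy ys ^^ k) v = v}"
proof -
  obtain N where N: "N \<in> carrier_mat (length xs) (length xs)"
    "arrow_gram xs * N = 1\<^sub>m (length xs)" "N * arrow_gram xs = 1\<^sub>m (length xs)"
    using arrow_gram_inverse .
  obtain N' where N': "N' \<in> carrier_mat (length ys) (length ys)"
    "arrow_gram ys * N' = 1\<^sub>m (length ys)" "N' * arrow_gram ys = 1\<^sub>m (length ys)"
    using arrow_gram_inverse .
  have "mtrace ((1\<^sub>m (length xs) - N' * (arrow_gram ys + transpose_mat (arrow_gram ys))) ^\<^sub>m k) =
    mtrace ((1\<^sub>m (length xs) - N * (arrow_gram xs + transpose_mat (arrow_gram xs))) ^\<^sub>m k)"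
    using N N' assms arrow_gram_carrier[of xs] by (intro mat_congruent_mtrace_coxeter) simp_all
  then show ?thesis
    using mtrace_coxeter_arrow_gram[OF assms(1) N(1,2), of k]
      mtrace_coxeter_arrow_gram[OF assms(2) N'(1,2), of k] assms(3) by simp
qed

section \<open>Standard quivers\<close>

definition std_arrows :: "nat \<Rightarrow> nat list \<Rightarrow> nat \<Rightarrow> (nat \<times> nat) list" where
  "std_arrows m \<pi> d = map (std_arrow m \<pi>) [1..<Suc ((m - 1) + (length \<pi> - 1) + 2 * d)]"

lemma monodromy_path:
  assumes "m \<ge> 1"
  shows "monodromy (map (\<lambda>a. (a, Suc a)) [1..<m]) x =
    (if x = 1 then m else if 2 \<le> x \<and> x \<le> m then x - 1 else x)"
  using assms
proof (induction m rule: dec_induct)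
  case (step m)
  then show ?case
    by (auto simp: monodromy_append arrow_swap_def Transposition.transpose_def)
qed auto

text \<open>Serves the arrows \<open>j\<^sub>t\<close>: their product permutes the vertices
  \<open>std_vertex m \<pi> t\<close> cyclically and, after the full cycle given by the path, cuts
  that cycle at these vertices.\<close>

lemma monodromy_chain:
  assumes "inj_on v {..k}"
  shows "monodromy (map (\<lambda>t. (v t, v (Suc t))) [0..<k]) (v 0) = v k"
    and "\<And>t. t < k \<Longrightarrow> monodromy (map (\<lambda>t. (v t, v (Suc t))) [0..<k]) (v (Suc t)) = v t"
    and "\<And>x. x \<notin> v ` {..k} \<Longrightarrow> monodromy (map (\<lambda>t. (v t, v (Suc t))) [0..<k]) x = x"
proof -
  define J where "J = (\<lambda>k. monodromy (map (\<lambda>t. (v t, v (Suc t))) [0..<k]))"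
  have "J k (v 0) = v k \<and> (\<forall>t<k. J k (v (Suc t)) = v t) \<and> (\<forall>x. x \<notin> v ` {..k} \<longrightarrow> J k x = x)"
    using assms
  proof (induction k)
    case (Suc k)
    have inj: "v i = v j \<longleftrightarrow> i = j" if "i \<le> Suc k" "j \<le> Suc k" for i j
      using Suc.prems that by (auto simp: inj_on_eq_iff)
    have "inj_on v {..k}" using Suc.prems by (rule inj_on_subset) auto
    note IH = Suc.IH[OF this]
    have J: "J (Suc k) x = arrow_swap (v k, v (Suc k)) (J k x)" for x
      by (simp add: J_def monodromy_append)
    have "v (Suc k) \<notin> v ` {..k}" using inj by auto
    then have last: "J k (v (Suc k)) = v (Suc k)" using IH by blast
    have "J (Suc k) (v (Suc t)) = v t" if "t < Suc k" for t
    proof (cases "t = k")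
      case False
      then have "J k (v (Suc t)) = v t" using IH that by simp
      then show ?thesis using J False that by (simp add: arrow_swap_def inj)
    qed (simp add: J last arrow_swap_def)
    moreover have "J (Suc k) x = x" if "x \<notin> v ` {..Suc k}" for x
    proof -
      have "x \<notin> v ` {..k}" using that by auto
      then have "J k x = x" using IH by blast
      moreover have "x \<noteq> v k" "x \<noteq> v (Suc k)" using that by auto
      ultimately show ?thesis by (simp add: J arrow_swap_def)
    qed
    ultimately show ?case using IH by (simp add: J arrow_swap_def)
  qed (simp add: J_def)
  then show "monodromy (map (\<lambda>t. (v t, v (Suc t))) [0..<k]) (v 0) = v k"
    "\<And>t. t < k \<Longrightarrow> monodromy (map (\<lambda>t. (v t, v (Suc t))) [0..<k]) (v (Suc t)) = v t"
    "\<And>x. x \<notin> v ` {..k} \<Longrightarrow> monodromy (map (\<lambda>t. (v t, v (Suc t))) [0..<k]) x = x"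
    unfolding J_def by blast+
qed

lemma arrows_on_append: "arrows_on V (xs @ ys) \<longleftrightarrow> arrows_on V xs \<and> arrows_on V ys"
  by (auto simp: arrows_on_def)

lemma monodromy_cong_arrow_swap:
  "(\<And>w. w \<in> set xs \<Longrightarrow> arrow_swap w = arrow_swap u) \<Longrightarrow> monodromy xs = monodromy (replicate (length xs) u)"
  by (induction xs) auto

context
  fixes m :: nat and \<pi> :: "nat list"
  assumes m: "m \<ge> 2" and part: "partition_of m \<pi>"
begin

private lemma sum_list_take_le: "sum_list (take t \<pi>) \<le> m"
  using part sum_list_append[of "take t \<pi>" "drop t \<pi>"]
  by (simp add: partition_of_def)

private lemma length_pos: "length \<pi> \<ge> 1"
  using part m by (cases \<pi>) (auto simp: partition_of_def)

lemma std_vertex_0: "std_vertex m \<pi> 0 = m"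
  by (simp add: std_vertex_def)

lemma std_vertex_length: "length \<pi> \<le> t \<Longrightarrow> std_vertex m \<pi> t = 0"
  using part by (simp add: std_vertex_def partition_of_def)

lemma std_vertex_Suc: "t < length \<pi> \<Longrightarrow> std_vertex m \<pi> t = std_vertex m \<pi> (Suc t) + \<pi> ! t"
  using sum_list_take_le[of "Suc t"] by (simp add: std_vertex_def take_Suc_conv_app_nth)

private lemma part_pos: "t < length \<pi> \<Longrightarrow> \<pi> ! t > 0"
  using part by (simp add: partition_of_def)

lemma std_vertex_mono: "t < u \<Longrightarrow> u \<le> length \<pi> \<Longrightarrow> std_vertex m \<pi> u < std_vertex m \<pi> t"
proof (induction u)
  case (Suc u)
  then show ?case
    using std_vertex_Suc[of u] part_pos[of u] by (cases "t = u") auto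
qed simp

private lemma std_vertex_range: "t < length \<pi> \<Longrightarrow> std_vertex m \<pi> t \<in> {1..m}"
  using std_vertex_Suc[of t] part_pos[of t] by (auto simp: std_vertex_def)

private abbreviation "path \<equiv> map (\<lambda>a. (a, Suc a)) [1..<m]"
private abbreviation "jumps \<equiv>
  map (\<lambda>t. (std_vertex m \<pi> t, std_vertex m \<pi> (Suc t))) [0..<length \<pi> - 1]"

text \<open>Of the arrows \<open>k\<^sub>t\<close> the later proofs use that their number is even
  and that all of them join the ends of one arrow of the base, so that their product is
  trivial.\<close>

private lemma std_arrows_split:
  obtains s t ks where "std_arrows m \<pi> d = path @ jumps @ ks" "length ks = 2 * d"
    "(s, t) \<in> set (path @ jumps)" "set ks \<subseteq> {(s, t), (t, s)}"
proof -
  let ?b = "(m - 1) + (length \<pi> - 1)"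
  let ?\<alpha> = "if length \<pi> = 1 then m - 1 else ?b"
  obtain s t where st: "std_base_arrow m \<pi> ?\<alpha> = (s, t)" by force
  define ks where "ks = map (std_arrow m \<pi>) [Suc ?b..<Suc (?b + 2 * d)]"
  have base: "map (std_base_arrow m \<pi>) [1..<Suc ?b] = path @ jumps"
  proof (rule nth_equalityI)
    show "length (map (std_base_arrow m \<pi>) [1..<Suc ?b]) = length (path @ jumps)"
      by (simp del: upt_Suc)
    fix i assume "i < length (map (std_base_arrow m \<pi>) [1..<Suc ?b])"
    then show "map (std_base_arrow m \<pi>) [1..<Suc ?b] ! i = (path @ jumps) ! i"
      using m by (auto simp: nth_append std_base_arrow_def Let_def Suc_diff_le simp del: upt_Suc)
  qed
  have "[1..<Suc (?b + 2 * d)] = [1..<Suc ?b] @ [Suc ?b..<Suc (?b + 2 * d)]"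
    using upt_add_eq_append[of 1 "Suc ?b" "2 * d"] by simp
  then have "std_arrows m \<pi> d = map (std_arrow m \<pi>) [1..<Suc ?b] @ ks"
    unfolding std_arrows_def ks_def by (simp only: map_append)
  also have "map (std_arrow m \<pi>) [1..<Suc ?b] = map (std_base_arrow m \<pi>) [1..<Suc ?b]"
    by (rule map_cong) (auto simp: std_arrow_def Let_def)
  finally have 1: "std_arrows m \<pi> d = path @ jumps @ ks" using base by simp
  have "?\<alpha> \<in> set [1..<Suc ?b]" using m length_pos by auto
  then have "std_base_arrow m \<pi> ?\<alpha> \<in> set (map (std_base_arrow m \<pi>) [1..<Suc ?b])"
    unfolding set_map by (rule imageI)
  then have 2: "(s, t) \<in> set (path @ jumps)" unfolding st base .
  have 3: "set ks \<subseteq> {(s, t), (t, s)}"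
    unfolding ks_def using st by (auto simp: std_arrow_def Let_def split: if_splits)
  have 4: "length ks = 2 * d" by (simp add: ks_def)
  show thesis by (rule that[OF 1 4 2 3])
qed

lemma std_arrows_on: "arrows_on {1..m} (std_arrows m \<pi> d)"
proof -
  obtain s t ks where *: "std_arrows m \<pi> d = path @ jumps @ ks" "length ks = 2 * d"
    "(s, t) \<in> set (path @ jumps)" "set ks \<subseteq> {(s, t), (t, s)}"
    by (rule std_arrows_split)
  have "std_vertex m \<pi> t \<in> {1..m} \<and> std_vertex m \<pi> (Suc t) \<in> {1..m} \<and>
      std_vertex m \<pi> t \<noteq> std_vertex m \<pi> (Suc t)" if "t < length \<pi> - 1" for t
  proof -
    have "Suc t < length \<pi>" using that by simp
    then show ?thesis
      using std_vertex_range[of t] std_vertex_range[of "Suc t"] std_vertex_mono[of t "Suc t"] by simp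
  qed
  then have "arrows_on {1..m} jumps" by (auto simp: arrows_on_def)
  moreover have "arrows_on {1..m} path" by (auto simp: arrows_on_def)
  ultimately have on: "arrows_on {1..m} (path @ jumps)" by (simp only: arrows_on_append)
  then have "s \<in> {1..m} \<and> t \<in> {1..m} \<and> s \<noteq> t"
    using *(3) unfolding arrows_on_def by blast
  then have "arrows_on {1..m} ks" using *(4) unfolding arrows_on_def by blast
  with on show ?thesis unfolding *(1) arrows_on_append by simp
qed

lemma std_arrows_linked: "linked {1..m} (std_arrows m \<pi> d)"
  unfolding linked_def
proof (intro allI impI)
  fix S assume S: "S \<subseteq> {1..m}" "S \<noteq> {}" "saturated (std_arrows m \<pi> d) S"
  obtain ks where *: "std_arrows m \<pi> d = path @ jumps @ ks"
    using std_arrows_split by metis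
  have step: "a \<in> S \<longleftrightarrow> Suc a \<in> S" if "1 \<le> a" "a < m" for a
    using S(3) that unfolding * saturated_def by auto
  have all: "a \<in> S \<longleftrightarrow> 1 \<in> S" if "1 \<le> a" "a \<le> m" for a
    using that by (induction a rule: dec_induct) (use step in auto)
  obtain x where "x \<in> S" using S(2) by blast
  then have "1 \<in> S" using S(1) all[of x] by auto
  then have "{1..m} \<subseteq> S" using all by auto
  with S(1) show "S = {1..m}" by (rule equalityI)
qed

text \<open>The path gives the descent \<open>x\<close> to \<open>x - 1\<close>, with 1 sent to
  \<open>m\<close>. The jumps send \<open>std_vertex m \<pi> (Suc t)\<close> up to
  \<open>std_vertex m \<pi> t\<close>, so a descent leaving a block at its bottom reenters the same
  block at its top.\<close>

lemma std_arrows_cycle_type: "cycle_type {1..m} (monodromy (std_arrows m \<pi> d)) \<pi>"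
proof -
  let ?v = "std_vertex m \<pi>" and ?l = "length \<pi>"
  \<comment> \<open>Row \<open>t\<close> lists its block downwards from the top \<open>?v t\<close>
    to \<open>?v (Suc t) + 1\<close>.\<close>
  define h where "h = (\<lambda>(t, i). ?v t - i)"
  obtain s t ks where *: "std_arrows m \<pi> d = path @ jumps @ ks" "length ks = 2 * d"
    "(s, t) \<in> set (path @ jumps)" "set ks \<subseteq> {(s, t), (t, s)}"
    by (rule std_arrows_split)
  have "monodromy ks = monodromy (replicate (2 * d) (s, t))"
    using *(4) unfolding *(2)[symmetric] by (intro monodromy_cong_arrow_swap) (auto simp: arrow_swap_flip)
  then have mon: "monodromy (std_arrows m \<pi> d) = monodromy jumps \<circ> monodromy path"
    unfolding *(1) by (simp add: monodromy_append monodromy_replicate)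
  have inj: "inj_on ?v {..?l - 1}"
  proof (rule linorder_inj_onI)
    show "?v x \<noteq> ?v y" if "x < y" "x \<in> {..?l - 1}" "y \<in> {..?l - 1}" for x y
    proof -
      have "y \<le> ?l" using that by simp
      then show ?thesis using std_vertex_mono[of x y] that by simp
    qed
  qed auto
  note chain = monodromy_chain[OF inj]
  have "{1..m} \<subseteq> h ` cells \<pi>"
  proof
    fix x assume x: "x \<in> {1..m}"
    \<comment> \<open>The block of \<open>x\<close> is the last one whose top is at least
      \<open>x\<close>, that is, the one just before the first \<open>?v u\<close> below
      \<open>x\<close>.\<close>
    define u where "u = (LEAST u. ?v u < x)"
    have "?v ?l < x" using x std_vertex_length[of ?l] by simp
    then have u: "?v u < x" unfolding u_def by (rule LeastI[where P = "\<lambda>u. ?v u < x"])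
    have "u \<noteq> 0"
    proof
      assume "u = 0"
      then show False using u x std_vertex_0 by simp
    qed
    then obtain t where t: "u = Suc t" using not0_implies_Suc by blast
    then have "x \<le> ?v t" using not_less_Least[of t "\<lambda>u. ?v u < x", folded u_def] by simp
    moreover from this have tl: "t < ?l" using x std_vertex_length[of t] by (cases "t < ?l") auto
    ultimately have "(t, ?v t - x) \<in> cells \<pi>" "x = h (t, ?v t - x)"
      using u t std_vertex_Suc[OF tl] by (auto simp: h_def)
    then show "x \<in> h ` cells \<pi>" by blast
  qed
  moreover have "h ` cells \<pi> \<subseteq> {1..m}"
  proof
    fix x assume "x \<in> h ` cells \<pi>"
    then obtain t i where x: "x = ?v t - i" "t < ?l" "i < \<pi> ! t" by (auto simp: h_def cells_def)
    then show "x \<in> {1..m}" using std_vertex_Suc[OF x(2)] std_vertex_range[OF x(2)] by auto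
  qed
  ultimately have im: "h ` cells \<pi> = {1..m}" by blast
  have "card (cells \<pi>) = (\<Sum>t<?l. \<pi> ! t)" by (simp add: cells_def)
  also have "\<dots> = m" using part by (simp add: partition_of_def sum_list_sum_nth lessThan_atLeast0)
  finally have "inj_on h (cells \<pi>)" using im by (intro eq_card_imp_inj_on) auto
  with im have bij: "bij_betw h (cells \<pi>) {1..m}" by (simp add: bij_betw_def)
  show ?thesis
  proof (rule cycle_typeI[OF _ bij])
    show "p > 0" if "p \<in> set \<pi>" for p using part that by (simp add: partition_of_def)
    fix t i assume ti: "t < ?l" "i < \<pi> ! t"
    note vt = std_vertex_Suc[OF ti(1)] std_vertex_range[OF ti(1)]
    show "monodromy (std_arrows m \<pi> d) (h (t, i)) = h (t, Suc i mod \<pi> ! t)"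
    proof (cases "Suc i < \<pi> ! t")
      case True
      have "monodromy path (?v t - i) = ?v t - Suc i"
        using vt ti True m by (subst monodromy_path) auto
      \<comment> \<open>Inside a block the descent stays strictly between two consecutive tops, and
        the jumps fix such vertices.\<close>
      moreover have "?v t - Suc i \<notin> ?v ` {..?l - 1}"
      proof
        assume "?v t - Suc i \<in> ?v ` {..?l - 1}"
        then obtain u where u: "u \<le> ?l - 1" "?v t - Suc i = ?v u" by auto
        then have "?v (Suc t) < ?v u" "?v u < ?v t" using vt True by auto
        moreover have "u \<le> ?l" using u(1) by simp
        ultimately show False
          using std_vertex_mono[of u t] std_vertex_mono[of "Suc t" u] ti(1)
          by (cases u t rule: linorder_cases; cases "u = Suc t") auto
      qed
      ultimately show ?thesis using True chain(3) by (simp add: mon h_def)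
    next
      case False
      then have i: "Suc i = \<pi> ! t" using ti by simp
      then have vi: "?v t - i = Suc (?v (Suc t))" using vt by simp
      have "monodromy jumps (monodromy path (Suc (?v (Suc t)))) = ?v t"
      proof (cases "Suc t < ?l")
        case True
        then have "monodromy path (Suc (?v (Suc t))) = ?v (Suc t)"
          using std_vertex_range[OF True] std_vertex_mono[of t "Suc t"] vt m
          by (subst monodromy_path) auto
        then show ?thesis using chain(2)[of t] True by simp
      next
        case False
        \<comment> \<open>In the last block the bottom is the vertex 1: the path sends it to
          \<open>m\<close>, which is \<open>?v 0\<close>, and the chain of jumps carries
          \<open>?v 0\<close> to its last vertex.\<close>
        then have "t = ?l - 1" "?v (Suc t) = 0" using ti std_vertex_length[of "Suc t"] by auto
        then show ?thesis using m chain(1) std_vertex_0 by (subst monodromy_path) auto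
      qed
      then show ?thesis using i vi by (simp add: mon h_def)
    qed
  qed
qed

lemma upper_gram_std_quiver:
  fixes d :: nat
  defines "n \<equiv> num_arrows (std_quiver m \<pi> d)"
  shows "upper_gram n (quiver_form (std_quiver m \<pi> d)) = arrow_gram (std_arrows m \<pi> d)"
proof (rule upper_gram_arrows[OF _ std_arrows_on])
  let ?Q = "std_quiver m \<pi> d" and ?xs = "std_arrows m \<pi> d"
  show len: "length ?xs = n" by (simp add: n_def std_arrows_def std_quiver_def del: upt_Suc)
  have nth: "?xs ! a = (source ?Q (Suc a), target ?Q (Suc a))" if "a < n" for a
    using that by (simp add: std_arrows_def n_def std_quiver_def nth_append del: upt_Suc)
  have st: "source ?Q a \<in> {1..num_vertices ?Q} \<and> target ?Q a \<in> {1..num_vertices ?Q}"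
    if "a \<in> {1..num_arrows ?Q}" for a
  proof -
    have "a - 1 < n" "Suc (a - 1) = a" using that by (auto simp: n_def)
    then have "(source ?Q a, target ?Q a) \<in> set ?xs"
      using nth[of "a - 1"] nth_mem[of "a - 1" ?xs] len by simp
    moreover have "num_vertices ?Q = m" by (simp add: std_quiver_def)
    ultimately show ?thesis
      using std_arrows_on[of d] unfolding arrows_on_def by fastforce
  qed
  fix x :: "int vec" assume x: "x \<in> carrier_vec n"
  let ?y = "incidence_mat ?Q *\<^sub>v x"
  have y: "?y $ v = (\<Sum>i<n. x $ i * incidence (?xs ! i) (Suc v))" if "v < m" for v
  proof -
    have "?y $ v = (\<Sum>i<n. incidence_mat ?Q $$ (v, i) * x $ i)"
      using that x unfolding n_def
      by (auto simp: incidence_mat_def scalar_prod_def lessThan_atLeast0 std_quiver_def intro!: sum.cong)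
    also have "\<dots> = (\<Sum>i<n. x $ i * incidence (?xs ! i) (Suc v))"
    proof (rule sum.cong[OF refl])
      fix i assume "i \<in> {..<n}"
      then show "incidence_mat ?Q $$ (v, i) * x $ i = x $ i * incidence (?xs ! i) (Suc v)"
        using that nth[of i] by (simp add: incidence_mat_def incidence_def n_def std_quiver_def)
    qed
    finally show ?thesis .
  qed
  have "2 * quiver_form ?Q x = ?y \<bullet> ?y"
    using x st unfolding n_def by (intro quiver_form_double) auto
  also have "\<dots> = (\<Sum>v<m. (\<Sum>i<n. x $ i * incidence (?xs ! i) (Suc v))\<^sup>2)"
    using y by (simp add: scalar_prod_def incidence_mat_def std_quiver_def lessThan_atLeast0 power2_eq_square)
  also have "\<dots> = (\<Sum>v\<in>{1..m}. (\<Sum>i<n. x $ i * incidence (?xs ! i) v)\<^sup>2)"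
    by (rule sum.reindex_bij_betw) (rule bij_betw_byWitness[of _ "\<lambda>v. v - 1"], auto)
  finally show "2 * quiver_form ?Q x = (\<Sum>v\<in>{1..m}. (\<Sum>i<n. x $ i * incidence (?xs ! i) v)\<^sup>2)" .
qed simp

end

section \<open>Forms of Dynkin type A\<close>

text \<open>Makes the induced form well defined. The mixed term is the polarization at
  \<open>k\<close> and \<open>x\<close>, which vanishes, and \<open>q k\<close> vanishes because
  twice it is the polarization at \<open>k\<close> and \<open>k\<close>.\<close>

lemma rad_translation_invariant:
  assumes q: "integral_quadratic_form n q" and k: "k \<in> rad n q" and x: "x \<in> carrier_vec n"
  shows "q (k + x) = q x"
proof -
  obtain M where M: "M \<in> carrier_mat n n" and qM: "\<forall>x \<in> carrier_vec n. q x = x \<bullet> (M *\<^sub>v x)"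
    using ex1_implies_ex[OF ex1_upper_gram[OF q]] by blast
  let ?T = "transpose_mat M"
  have T: "?T \<in> carrier_mat n n" using M by simp
  have "gram n q = M + ?T"
    using M matrix_form_polarization(2)[OF M qM] by (intro eq_matI) (auto simp: gram_def)
  with k M have kc: "k \<in> carrier_vec n" and Gk: "(M + ?T) *\<^sub>v k = 0\<^sub>v n"
    by (auto simp: rad_def mat_kernel_def)
  have Mk: "M *\<^sub>v k \<in> carrier_vec n" "?T *\<^sub>v k \<in> carrier_vec n" "M *\<^sub>v x \<in> carrier_vec n"
    using M T kc x by auto
  have sym: "k \<bullet> (M *\<^sub>v y) + y \<bullet> (M *\<^sub>v k) = 0" if y: "y \<in> carrier_vec n" for y
  proof -
    have "k \<bullet> (M *\<^sub>v y) = y \<bullet> (?T *\<^sub>v k)"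
      using transpose_vec_mult_scalar[OF M y kc] comm_scalar_prod[OF y Mk(2)] by simp
    then have "k \<bullet> (M *\<^sub>v y) + y \<bullet> (M *\<^sub>v k) = y \<bullet> (M *\<^sub>v k + ?T *\<^sub>v k)"
      using scalar_prod_add_distrib[OF y Mk(1,2)] by simp
    also have "M *\<^sub>v k + ?T *\<^sub>v k = 0\<^sub>v n"
      using add_mult_distrib_mat_vec[OF M T kc] Gk by simp
    finally show ?thesis using y by simp
  qed
  have "q (k + x) = (k + x) \<bullet> (M *\<^sub>v k + M *\<^sub>v x)"
    using qM kc x mult_add_distrib_mat_vec[OF M kc x] by simp
  also have "\<dots> = k \<bullet> (M *\<^sub>v k) + (k \<bullet> (M *\<^sub>v x) + x \<bullet> (M *\<^sub>v k)) + x \<bullet> (M *\<^sub>v x)"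
    using add_scalar_prod_distrib[OF kc x, of "M *\<^sub>v k + M *\<^sub>v x"] Mk
      scalar_prod_add_distrib[OF kc Mk(1,3)] scalar_prod_add_distrib[OF x Mk(1,3)] by simp
  also have "\<dots> = q x" using sym[OF x] sym[OF kc] qM x by simp
  finally show ?thesis .
qed

lemma rad_subgroup: "subgroup (rad n q) (monoid_vec TYPE(int) n)"
proof -
  interpret comm_group "monoid_vec TYPE(int) n" by (rule comm_group_vec)
  let ?G = "gram n q"
  have G: "?G \<in> carrier_mat n n" by (simp add: gram_def)
  have rad: "x \<in> rad n q \<longleftrightarrow> x \<in> carrier_vec n \<and> ?G *\<^sub>v x = 0\<^sub>v n" for x
    using G by (auto simp: rad_def mat_kernel_def)
  show ?thesis
  proof (rule subgroupI)
    show "rad n q \<subseteq> carrier (monoid_vec TYPE(int) n)"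
      by (auto simp: rad monoid_vec_simps)
    have "0\<^sub>v n \<in> rad n q" using G by (auto simp: rad)
    then show "rad n q \<noteq> {}" by blast
    fix a assume a: "a \<in> rad n q"
    have "inv\<^bsub>monoid_vec TYPE(int) n\<^esub> a = - a"
      using a by (intro inv_equality) (auto simp: rad monoid_vec_simps)
    moreover have "?G *\<^sub>v (- a) = 0\<^sub>v n"
      using a G by (auto simp: rad mult_minus_distrib_mat_vec simp flip: zero_minus_vec)
    ultimately show "inv\<^bsub>monoid_vec TYPE(int) n\<^esub> a \<in> rad n q"
      using a by (simp add: rad)
    fix b assume b: "b \<in> rad n q"
    show "a \<otimes>\<^bsub>monoid_vec TYPE(int) n\<^esub> b \<in> rad n q"
      using a b mult_add_distrib_mat_vec[OF G, of a b] by (simp add: rad monoid_vec_simps)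
  qed
qed

text \<open>Replaces the isomorphism with the quotient group by an additive surjection through which
  \<open>q\<close> factors, so that no cosets occur afterwards.\<close>

lemma dynkin_type_projection:
  assumes q: "integral_quadratic_form n q" and "has_dynkin_type n q \<Delta>"
  defines "r \<equiv> dynkin_rank \<Delta>"
  obtains \<psi> where "\<And>x. x \<in> carrier_vec n \<Longrightarrow> \<psi> x \<in> carrier_vec r"
    "\<And>x y. x \<in> carrier_vec n \<Longrightarrow> y \<in> carrier_vec n \<Longrightarrow> \<psi> (x + y) = \<psi> x + \<psi> y"
    "\<And>y. y \<in> carrier_vec r \<Longrightarrow> \<exists>x \<in> carrier_vec n. \<psi> x = y"
    "\<And>x. x \<in> carrier_vec n \<Longrightarrow> q x = dynkin_form \<Delta> (\<psi> x)"
proof -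
  let ?Zn = "monoid_vec TYPE(int) n" and ?Zr = "monoid_vec TYPE(int) r"
  let ?R = "rad n q" and ?coset = "\<lambda>x. rad n q #>\<^bsub>monoid_vec TYPE(int) n\<^esub> x"
  obtain \<phi> where \<phi>: "\<phi> \<in> iso ?Zr (?Zn Mod ?R)"
    and form: "\<And>y. y \<in> carrier_vec r \<Longrightarrow> induced_form q (\<phi> y) = dynkin_form \<Delta> y"
    using assms unfolding has_dynkin_type_def by blast
  interpret Zn: comm_group ?Zn by (rule comm_group_vec)
  interpret Zr: comm_group ?Zr by (rule comm_group_vec)
  interpret N: normal ?R ?Zn by (rule Zn.subgroup_imp_normal[OF rad_subgroup])
  define \<psi> where "\<psi> = inv_into (carrier ?Zr) \<phi> \<circ> ?coset"
  have bij: "bij_betw \<phi> (carrier ?Zr) (carrier (?Zn Mod ?R))"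
    using \<phi> by (simp add: iso_def)
  have hom: "\<psi> \<in> hom ?Zn ?Zr"
    unfolding \<psi>_def by (rule hom_compose[OF N.r_coset_hom_Mod iso_imp_homomorphism[OF Zr.iso_set_sym[OF \<phi>]]])
  have coset: "?coset x \<in> carrier (?Zn Mod ?R)" if "x \<in> carrier_vec n" for x
    using N.r_coset_hom_Mod that by (auto simp: hom_def monoid_vec_simps)
  have \<phi>\<psi>: "\<phi> (\<psi> x) = ?coset x" if "x \<in> carrier_vec n" for x
    using bij coset[OF that] unfolding \<psi>_def comp_apply bij_betw_def by (metis f_inv_into_f)
  have closed: "\<psi> x \<in> carrier_vec r" if "x \<in> carrier_vec n" for x
    using hom that by (auto simp: hom_def monoid_vec_simps)
  show thesis
  proof (rule that)
    show "\<psi> x \<in> carrier_vec r" if "x \<in> carrier_vec n" for x by (rule closed[OF that])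
    show "\<psi> (x + y) = \<psi> x + \<psi> y" if "x \<in> carrier_vec n" "y \<in> carrier_vec n" for x y
      using hom that by (auto simp: hom_def monoid_vec_simps)
    show "\<exists>x \<in> carrier_vec n. \<psi> x = y" if y: "y \<in> carrier_vec r" for y
    proof -
      have "\<phi> y \<in> rcosets\<^bsub>?Zn\<^esub> ?R"
        using bij y by (auto simp: bij_betw_def monoid_vec_simps FactGroup_def)
      then obtain x where x: "x \<in> carrier_vec n" "\<phi> y = ?coset x"
        by (auto simp: RCOSETS_def monoid_vec_simps)
      have "\<psi> x = y"
        using bij y unfolding \<psi>_def comp_apply x(2)[symmetric] bij_betw_def
        by (simp add: monoid_vec_simps)
      with x show ?thesis by blast
    qed
    show "q x = dynkin_form \<Delta> (\<psi> x)" if x: "x \<in> carrier_vec n" for x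
    proof -
      have "q ` ?coset x = {q x}"
      proof -
        have "?coset x = (\<lambda>k. k + x) ` ?R" by (auto simp: r_coset_def monoid_vec_simps)
        moreover have "q ` (\<lambda>k. k + x) ` ?R = (\<lambda>_. q x) ` ?R"
          unfolding image_image using rad_translation_invariant[OF q _ x] by (intro image_cong) auto
        moreover have "(\<lambda>_. q x) ` ?R = {q x}"
          by (rule image_constant[OF N.one_closed])
        ultimately show ?thesis by simp
      qed
      then have "induced_form q (?coset x) = q x" by (simp add: induced_form_def)
      with form[OF closed[OF x]] \<phi>\<psi>[OF x] show ?thesis by simp
    qed
  qed
qed

section \<open>The root lattice of type A in coordinates of sum zero\<close>

lemma additive_int:
  fixes g :: "int \<Rightarrow> int"
  assumes "\<And>a b. g (a + b) = g a + g b"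
  shows "g a = a * g 1"
proof (induction a rule: int_induct[of _ 0])
  case base
  show ?case using assms[of 0 0] by simp
next
  case (step1 i)
  then show ?case using assms[of i 1] by (simp add: algebra_simps)
next
  case (step2 i)
  then show ?case using assms[of "i - 1" 1] by (simp add: algebra_simps)
qed

lemma additive_vec:
  fixes f :: "int vec \<Rightarrow> int"
  assumes add: "\<And>x y. x \<in> carrier_vec n \<Longrightarrow> y \<in> carrier_vec n \<Longrightarrow> f (x + y) = f x + f y"
    and x: "x \<in> carrier_vec n"
  shows "f x = (\<Sum>i<n. x $ i * f (unit_vec n i))"
proof -
  define p where "p = (\<lambda>k. vec n (\<lambda>i. if i < k then x $ i else 0))"
  have smult: "f (a \<cdot>\<^sub>v u) = a * f u" if u: "u \<in> carrier_vec n" for a u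
  proof -
    have "f ((a + b) \<cdot>\<^sub>v u) = f (a \<cdot>\<^sub>v u) + f (b \<cdot>\<^sub>v u)" for a b
      using u by (simp add: add_smult_distrib_vec add)
    from additive_int[of "\<lambda>a. f (a \<cdot>\<^sub>v u)", OF this] show ?thesis using u by simp
  qed
  have "f (p k) = (\<Sum>i<k. x $ i * f (unit_vec n i))" if "k \<le> n" for k
    using that
  proof (induction k)
    case 0
    have "p 0 = 0 \<cdot>\<^sub>v p 0" by (intro eq_vecI) (auto simp: p_def)
    then have "f (p 0) = 0" using smult[of "p 0" 0] by (simp add: p_def)
    then show ?case by simp
  next
    case (Suc k)
    have "p (Suc k) = p k + x $ k \<cdot>\<^sub>v unit_vec n k"
      using Suc.prems by (intro eq_vecI) (auto simp: p_def less_Suc_eq)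
    then have "f (p (Suc k)) = f (p k) + x $ k * f (unit_vec n k)"
      using add[of "p k" "x $ k \<cdot>\<^sub>v unit_vec n k"] smult[of "unit_vec n k" "x $ k"] by (simp add: p_def)
    then show ?case using Suc by simp
  qed
  moreover have "p n = x" using x by (intro eq_vecI) (auto simp: p_def)
  ultimately show ?thesis by (metis order_refl)
qed

text \<open>Coordinates in the simple roots \<open>e\<^sub>i - e\<^sub>i\<^sub>+\<^sub>1\<close>,
  numbered from 1 and extended by zero on both sides; the difference of the values at
  \<open>v\<close> and \<open>v - 1\<close> is then the \<open>v\<close>-th coordinate of the
  lattice vector, without boundary cases.\<close>

definition pad :: "nat \<Rightarrow> int vec \<Rightarrow> nat \<Rightarrow> int" where
  "pad r y v = (if 1 \<le> v \<and> v \<le> r then y $ (v - 1) else 0)"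

lemma pad_add:
  "x \<in> carrier_vec r \<Longrightarrow> y \<in> carrier_vec r \<Longrightarrow> pad r (x + y) v = pad r x v + pad r y v"
  by (auto simp: pad_def)

text \<open>Summation by parts turns the Cartan matrix into a sum of squared differences, that is,
  the squared norm of the lattice vector among the vectors of sum zero in \<open>r + 1\<close>
  coordinates.\<close>

lemma dynkin_form_A:
  assumes y: "y \<in> carrier_vec r"
  shows "2 * dynkin_form (Dynkin_A r) y = (\<Sum>v=1..r + 1. (pad r y v - pad r y (v - 1))\<^sup>2)"
proof -
  let ?Y = "pad r y" and ?\<Delta> = "Dynkin_A r"
  have id: "(\<Sum>i<k. Y (Suc i) * (2 * Y (Suc i) - Y i - Y (i + 2))) =
      (\<Sum>i<k. (Y (Suc i) - Y i)\<^sup>2) + (Y k)\<^sup>2 - Y k * Y (Suc k)" if "Y 0 = 0" for Y :: "nat \<Rightarrow> int" and k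
    using that by (induction k) (simp_all add: power2_eq_square algebra_simps)
  let ?M = "2 \<cdot>\<^sub>m 1\<^sub>m r - adjacency_mat ?\<Delta>"
  have M: "?M \<in> carrier_mat r r" by (auto simp: adjacency_mat_def)
  have row: "(\<Sum>j<r. ?M $$ (i, j) * y $ i * y $ j) = ?Y (Suc i) * (2 * ?Y (Suc i) - ?Y i - ?Y (i + 2))"
    if i: "i < r" for i
  proof -
    have "(\<Sum>j<r. ?M $$ (i, j) * y $ i * y $ j) =
      (\<Sum>j<r. y $ i * (2 * (if j = i then y $ j else 0) - (if Suc j = i then y $ j else 0)
        - (if j = Suc i then y $ j else 0)))"
      using i by (intro sum.cong) (auto simp: adjacency_mat_def)
    also have "\<dots> = y $ i * (2 * (\<Sum>j<r. if j = i then y $ j else 0)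
        - (\<Sum>j<r. if Suc j = i then y $ j else 0) - (\<Sum>j<r. if j = Suc i then y $ j else 0))"
      by (simp only: sum_distrib_left[symmetric] sum_subtractf)
    also have "(\<Sum>j<r. if Suc j = i then y $ j else 0) = ?Y i"
    proof (cases i)
      case (Suc k)
      then show ?thesis using i by (simp add: pad_def)
    qed (simp add: pad_def)
    also have "(\<Sum>j<r. if j = Suc i then y $ j else 0) = ?Y (i + 2)"
      by (simp add: pad_def)
    finally show ?thesis using i by (simp add: pad_def)
  qed
  have "2 * dynkin_form ?\<Delta> y = y \<bullet> (?M *\<^sub>v y)"
    using dynkin_form_double[of y ?\<Delta>] y by simp
  also have "\<dots> = (\<Sum>i<r. \<Sum>j<r. ?M $$ (i, j) * y $ i * y $ j)"
    by (rule scalar_prod_mult_mat_vec[OF M y])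
  also have "\<dots> = (\<Sum>i<r. ?Y (Suc i) * (2 * ?Y (Suc i) - ?Y i - ?Y (i + 2)))"
    using row by (intro sum.cong) auto
  also have "\<dots> = (\<Sum>i<r. (?Y (Suc i) - ?Y i)\<^sup>2) + (?Y r)\<^sup>2 - ?Y r * ?Y (Suc r)"
    by (rule id) (simp add: pad_def)
  \<comment> \<open>The zero after the last coordinate kills the cross term and makes
    \<open>(?Y r)\<^sup>2\<close> the square belonging to the vertex \<open>r + 1\<close>.\<close>
  also have "\<dots> = (\<Sum>i<Suc r. (?Y (Suc i) - ?Y i)\<^sup>2)"
    by (simp add: pad_def[of r y "Suc r"])
  also have "\<dots> = (\<Sum>v=1..r + 1. (?Y v - ?Y (v - 1))\<^sup>2)"
    by (rule sum.reindex_bij_witness[of _ "\<lambda>v. v - 1" Suc]) auto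
  finally show ?thesis .
qed

text \<open>Sum zero forces a positive and a negative entry. Their squares already use up the total
  2, so they are 1 and -1 and all other entries vanish.\<close>

lemma norm_two_sum_zero:
  fixes f :: "'a \<Rightarrow> int"
  assumes V: "finite V" and sq: "(\<Sum>v\<in>V. (f v)\<^sup>2) = 2" and s0: "(\<Sum>v\<in>V. f v) = 0"
  obtains s t where "s \<in> V" "t \<in> V" "s \<noteq> t" "\<And>v. v \<in> V \<Longrightarrow> f v = incidence (s, t) v"
proof -
  have nz: "\<not> (\<forall>v\<in>V. f v = 0)"
  proof
    assume "\<forall>v\<in>V. f v = 0"
    then have "(\<Sum>v\<in>V. (f v)\<^sup>2) = 0" by (intro sum.neutral) simp
    with sq show False by simp
  qed
  obtain s where s: "s \<in> V" "f s > 0"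
  proof (rule ccontr)
    assume "\<not> thesis"
    then have "\<forall>v\<in>V. - f v \<ge> 0" using that by force
    then have "\<forall>v\<in>V. - f v = 0"
      using sum_nonneg_eq_0_iff[OF V, of "\<lambda>v. - f v"] s0 by (simp add: sum_negf)
    then show False using nz by simp
  qed
  obtain t where t: "t \<in> V" "f t < 0"
  proof (rule ccontr)
    assume "\<not> thesis"
    then have "\<forall>v\<in>V. f v \<ge> 0" using that by force
    then have "\<forall>v\<in>V. f v = 0"
      using sum_nonneg_eq_0_iff[OF V, of f] s0 by simp
    then show False using nz by simp
  qed
  have st: "s \<noteq> t" using s t by auto
  let ?W = "V - {s} - {t}"
  have "(\<Sum>v\<in>V. (f v)\<^sup>2) = (f s)\<^sup>2 + ((f t)\<^sup>2 + (\<Sum>v\<in>?W. (f v)\<^sup>2))"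
    using V s(1) t(1) st by (simp add: sum.remove[of V s] sum.remove[of "V - {s}" t])
  moreover have W: "(\<Sum>v\<in>?W. (f v)\<^sup>2) \<ge> 0" by (intro sum_nonneg) simp
  moreover have sq_ge: "(f s)\<^sup>2 \<ge> f s" "(f t)\<^sup>2 \<ge> - f t"
    using s t self_le_power[of "f s" 2] self_le_power[of "- f t" 2] by simp_all
  ultimately have "f s = 1" "f t = - 1" "(\<Sum>v\<in>?W. (f v)\<^sup>2) = 0"
    using s t sq by linarith+
  moreover from this(3) have "f v = 0" if "v \<in> ?W" for v
    using that V by (subst (asm) sum_nonneg_eq_0_iff) auto
  ultimately have "f v = incidence (s, t) v" if "v \<in> V" for v
    using that st by (auto simp: incidence_def)
  with s t st show thesis by (intro that) auto
qed

text \<open>Each unit vector has norm 2 in the root lattice and so becomes an arrow; additivity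
  gives the whole form. Connectedness of the quiver comes from surjectivity: if a proper non-empty
  \<open>S\<close> were saturated, every lattice vector would have coordinate sum zero over
  \<open>S\<close>, unlike \<open>e\<^sub>a - e\<^sub>b\<close> with only \<open>a\<close> in
  \<open>S\<close>.\<close>

lemma dynkin_A_arrows:
  assumes unit: "unit_form n q" and type: "has_dynkin_type n q (Dynkin_A r)"
  obtains xs where "length xs = n" "arrows_on {1..r + 1} xs" "linked {1..r + 1} xs"
    "\<forall>x \<in> carrier_vec n. 2 * q x = (\<Sum>v=1..r + 1. (\<Sum>i<n. x $ i * incidence (xs ! i) v)\<^sup>2)"
proof -
  let ?V = "{1..r + 1}"
  have q: "integral_quadratic_form n q" and q1: "\<And>i. i < n \<Longrightarrow> q (unit_vec n i) = 1"
    using unit by (auto simp: unit_form_def)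
  obtain \<psi> where \<psi>: "\<And>x. x \<in> carrier_vec n \<Longrightarrow> \<psi> x \<in> carrier_vec r"
    "\<And>x y. x \<in> carrier_vec n \<Longrightarrow> y \<in> carrier_vec n \<Longrightarrow> \<psi> (x + y) = \<psi> x + \<psi> y"
    "\<And>y. y \<in> carrier_vec r \<Longrightarrow> \<exists>x \<in> carrier_vec n. \<psi> x = y"
    "\<And>x. x \<in> carrier_vec n \<Longrightarrow> q x = dynkin_form (Dynkin_A r) (\<psi> x)"
    using dynkin_type_projection[OF q type] unfolding dynkin_rank.simps by blast
  define D where "D = (\<lambda>y v. pad r y v - pad r y (v - 1))"
  have form: "2 * q x = (\<Sum>v\<in>?V. (D (\<psi> x) v)\<^sup>2)" if "x \<in> carrier_vec n" for x
    using dynkin_form_A[OF \<psi>(1)[OF that]] \<psi>(4)[OF that] by (simp add: D_def)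
  have sum0: "(\<Sum>v\<in>?V. D y v) = 0" for y
  proof -
    have "(\<Sum>v\<in>?V. D y v) = (\<Sum>i<Suc r. pad r y (Suc i) - pad r y i)"
      by (rule sum.reindex_bij_witness[of _ Suc "\<lambda>v. v - 1"]) (auto simp: D_def)
    also have "\<dots> = pad r y (Suc r) - pad r y 0"
      by (rule sum_lessThan_telescope)
    finally show ?thesis by (simp add: pad_def)
  qed
  have "\<exists>w. fst w \<in> ?V \<and> snd w \<in> ?V \<and> fst w \<noteq> snd w \<and>
      (\<forall>v\<in>?V. D (\<psi> (unit_vec n i)) v = incidence w v)" if i: "i < n" for i
  proof -
    have "(\<Sum>v\<in>?V. (D (\<psi> (unit_vec n i)) v)\<^sup>2) = 2"
      using form[of "unit_vec n i"] q1[OF i] by simp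
    then obtain s t where "s \<in> ?V" "t \<in> ?V" "s \<noteq> t"
      "\<And>v. v \<in> ?V \<Longrightarrow> D (\<psi> (unit_vec n i)) v = incidence (s, t) v"
      using norm_two_sum_zero[OF finite_atLeastAtMost _ sum0] by metis
    then show ?thesis by (intro exI[of _ "(s, t)"]) simp
  qed
  then obtain w where w: "\<And>i. i < n \<Longrightarrow> fst (w i) \<in> ?V \<and> snd (w i) \<in> ?V \<and> fst (w i) \<noteq> snd (w i) \<and>
      (\<forall>v\<in>?V. D (\<psi> (unit_vec n i)) v = incidence (w i) v)" by metis
  define xs where "xs = map w [0..<n]"
  have len: "length xs = n" and nth: "\<And>i. i < n \<Longrightarrow> xs ! i = w i" by (simp_all add: xs_def)
  have on: "arrows_on ?V xs"
    using w by (force simp: arrows_on_def xs_def)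
  have D: "D (\<psi> x) v = (\<Sum>i<n. x $ i * incidence (xs ! i) v)" if x: "x \<in> carrier_vec n" and v: "v \<in> ?V" for x v
  proof -
    have "D (\<psi> (x + y)) v = D (\<psi> x) v + D (\<psi> y) v"
      if "x \<in> carrier_vec n" "y \<in> carrier_vec n" for x y
      using \<psi>(1,2) that by (simp add: D_def pad_add)
    from additive_vec[of n "\<lambda>x. D (\<psi> x) v", OF this x]
    have "D (\<psi> x) v = (\<Sum>i<n. x $ i * D (\<psi> (unit_vec n i)) v)" .
    also have "\<dots> = (\<Sum>i<n. x $ i * incidence (xs ! i) v)"
      using w v nth by (intro sum.cong) auto
    finally show ?thesis .
  qed
  have "linked ?V xs"
    unfolding linked_def
  proof (intro allI impI)
    fix S assume S: "S \<subseteq> ?V" "S \<noteq> {}" "saturated xs S"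
    show "S = ?V"
    proof (rule ccontr)
      assume "S \<noteq> ?V"
      then obtain a b where ab: "a \<in> S" "b \<in> ?V" "b \<notin> S" using S by blast
      have fin: "finite S" using S(1) finite_subset by blast
      \<comment> \<open>The coefficients of \<open>e\<^sub>a - e\<^sub>b\<close> in the simple roots
        are its partial sums; \<open>tot\<close> makes them agree with \<open>pad\<close> at
        \<open>r + 1\<close> as well.\<close>
      define y where "y = vec r (\<lambda>i. \<Sum>u=1..i + 1. incidence (a, b) u)"
      have tot: "(\<Sum>u=1..r + 1. incidence (a, b) u) = 0"
      proof -
        have "arrows_on ?V [(a, b)]" using ab S(1) by (auto simp: arrows_on_def)
        from sum_incidence[OF _ this, of "\<lambda>_. 1"] show ?thesis by simp
      qed
      have pad: "pad r y v = (\<Sum>u=1..v. incidence (a, b) u)" if "v \<le> r + 1" for v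
        using that tot by (cases "v = r + 1"; cases v) (auto simp: pad_def y_def)
      have Dy: "D y v = incidence (a, b) v" if v: "v \<in> ?V" for v
      proof -
        obtain k where k: "v = Suc k" using v by (cases v) auto
        then show ?thesis using v pad[of v] pad[of k] by (simp add: D_def)
      qed
      obtain x where x: "x \<in> carrier_vec n" "\<psi> x = y"
        using \<psi>(3)[of y] by (auto simp: y_def)
      have "(\<Sum>v\<in>S. incidence (a, b) v) = (\<Sum>v\<in>S. \<Sum>i<n. x $ i * incidence (xs ! i) v)"
        using D[OF x(1)] Dy S(1) x(2) by (intro sum.cong) auto
      also have "\<dots> = (\<Sum>i<n. x $ i * (\<Sum>v\<in>S. incidence (xs ! i) v))"
        by (subst sum.swap) (simp add: sum_distrib_left)
      also have "\<dots> = 0"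
      proof (rule sum.neutral, rule ballI)
        fix i assume "i \<in> {..<n}"
        then have "xs ! i \<in> set xs" using len by simp
        from bspec[OF S(3)[unfolded saturated_def] this]
        have "fst (xs ! i) \<in> S \<longleftrightarrow> snd (xs ! i) \<in> S" by (simp add: case_prod_beta)
        then have "(\<Sum>v\<in>S. incidence (xs ! i) v) = 0"
          using fin by (simp add: incidence_def sum_subtractf of_bool_def)
        then show "x $ i * (\<Sum>v\<in>S. incidence (xs ! i) v) = 0" by simp
      qed
      finally have "(\<Sum>v\<in>S. incidence (a, b) v) = 0" .
      moreover have "(\<Sum>v\<in>S. incidence (a, b) v) = 1"
        using ab fin by (simp add: incidence_def sum_subtractf of_bool_def)
      ultimately show False by simp
    qed
  qed
  moreover have "2 * q x = (\<Sum>v\<in>?V. (\<Sum>i<n. x $ i * incidence (xs ! i) v)\<^sup>2)" if "x \<in> carrier_vec n" for x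
    using form[OF that] D[OF that] by simp
  ultimately show thesis using len on by (intro that) auto
qed

section \<open>Classification\<close>

lemma arrows_on_relabel:
  assumes "\<sigma> permutes V" "arrows_on V xs"
  shows "arrows_on V (map (map_prod \<sigma> \<sigma>) xs)"
  using assms(2) permutes_in_image[OF assms(1)] inj_eq[OF permutes_inj[OF assms(1)]]
  unfolding arrows_on_def by fastforce

lemma linked_relabel:
  assumes \<sigma>: "\<sigma> permutes V" and "linked V xs"
  shows "linked V (map (map_prod \<sigma> \<sigma>) xs)"
  unfolding linked_def
proof (intro allI impI)
  fix S assume S: "S \<subseteq> V" "S \<noteq> {}" "saturated (map (map_prod \<sigma> \<sigma>) xs) S"
  have "saturated xs (\<sigma> -` S)"
    using S(3) by (fastforce simp: saturated_def)
  moreover have "\<sigma> -` S \<subseteq> V" using S(1) permutes_in_image[OF \<sigma>] by auto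
  moreover have "\<sigma> -` S \<noteq> {}" using S(2) permutes_surj[OF \<sigma>] by (metis surj_image_vimage_eq image_empty)
  ultimately have "\<sigma> -` S = V" using assms(2) unfolding linked_def by blast
  then show "S = V"
    using permutes_image[OF \<sigma>] permutes_surj[OF \<sigma>] by (metis surj_image_vimage_eq)
qed

text \<open>The case \<open>k = 0\<close> of the fixed point count: every part divides 0 and the
  power is the identity.\<close>

lemma cycle_type_sum_list:
  assumes "cycle_type V c \<pi>"
  shows "sum_list \<pi> = card V"
  using cycle_type_card_fixed[OF assms, of 0] by simp

text \<open>A conjugation between the two products serves as a relabelling of the vertices. It
  leaves the matrix unchanged, since inner products of arrows see only coincidences of end points,
  and makes the products equal, so that Hurwitz's theorem applies.\<close>

lemma ex_congruent_std_arrows: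
  assumes m: "m \<ge> 2" and xs: "arrows_on {1..m} xs" "linked {1..m} xs"
  shows "\<exists>\<pi> d. partition_of m \<pi> \<and> length (std_arrows m \<pi> d) = length xs \<and>
    mat_congruent (length xs) (arrow_gram xs) (arrow_gram (std_arrows m \<pi> d))"
proof -
  let ?V = "{1..m}"
  have V: "finite ?V" "?V \<noteq> {}" using m by auto
  obtain \<pi>0 d where \<pi>0: "cycle_type ?V (monodromy xs) \<pi>0"
    and len: "length xs + 2 = m + length \<pi>0 + 2 * d"
    using riemann_hurwitz[OF V xs] by auto
  define \<pi> where "\<pi> = rev (sort \<pi>0)"
  have ct: "cycle_type ?V (monodromy xs) \<pi>"
    by (rule cycle_type_mset[OF \<pi>0]) (simp add: \<pi>_def)
  have "sorted_wrt (\<ge>) \<pi>"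
    by (simp add: \<pi>_def sorted_wrt_rev)
  then have part: "partition_of m \<pi>"
    using cycle_type_pos[OF ct] cycle_type_sum_list[OF ct] by (simp add: partition_of_def)
  let ?std = "std_arrows m \<pi> d"
  have "\<pi> \<noteq> []" using part m by (auto simp: partition_of_def)
  moreover have "length \<pi> = length \<pi>0" by (simp add: \<pi>_def)
  \<comment> \<open>The genus formula is exactly the arrow count
    \<open>(m - 1) + (length \<pi> - 1) + 2 * d\<close> of the standard quiver.\<close>
  ultimately have len_std: "length ?std = length xs"
    using len m by (cases \<pi>) (simp_all add: std_arrows_def del: upt_Suc)
  obtain \<sigma>0 where \<sigma>0: "bij_betw \<sigma>0 ?V ?V"
    "\<And>x. x \<in> ?V \<Longrightarrow> \<sigma>0 (monodromy xs x) = monodromy ?std (\<sigma>0 x)"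
    using cycle_type_conjugate[OF ct std_arrows_cycle_type[OF m part]] by metis
  \<comment> \<open>Products are functions on all natural numbers and have to agree everywhere, so
    the relabelling is extended by the identity outside the vertex set.\<close>
  define \<sigma> where "\<sigma> = (\<lambda>x. if x \<in> ?V then \<sigma>0 x else x)"
  have \<sigma>: "\<sigma> permutes ?V"
  proof (rule bij_imp_permutes)
    have "bij_betw \<sigma> ?V ?V = bij_betw \<sigma>0 ?V ?V" by (rule bij_betw_cong) (simp add: \<sigma>_def)
    with \<sigma>0(1) show "bij_betw \<sigma> ?V ?V" by simp
  qed (auto simp: \<sigma>_def)
  define ys where "ys = map (map_prod \<sigma> \<sigma>) xs"
  have mon: "monodromy ys (\<sigma> u) = monodromy ?std (\<sigma> u)" for u
  proof -
    have "monodromy ys (\<sigma> u) = \<sigma> (monodromy xs u)"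
      unfolding ys_def by (rule monodromy_relabel[OF permutes_bij[OF \<sigma>]])
    also have "\<dots> = monodromy ?std (\<sigma> u)"
    proof (cases "u \<in> ?V")
      case True
      then have "monodromy xs u \<in> ?V"
        using permutes_in_image[OF monodromy_permutes[OF xs(1)]] by simp
      then show ?thesis using True \<sigma>0(2) unfolding \<sigma>_def by simp
    next
      case False
      then have "\<sigma> u = u" unfolding \<sigma>_def by (rule if_not_P)
      then show ?thesis
        using monodromy_outside[OF xs(1) False] monodromy_outside[OF std_arrows_on[OF m part] False]
        by simp
    qed
    finally show ?thesis .
  qed
  have "monodromy ys = monodromy ?std"
  proof
    fix v
    obtain u where "v = \<sigma> u" using surjD[OF permutes_surj[OF \<sigma>], of v] by blast
    then show "monodromy ys v = monodromy ?std v" using mon by simp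
  qed
  then have "ys \<approx> ?std"
    using arrows_on_relabel[OF \<sigma> xs(1)] linked_relabel[OF \<sigma> xs(2)] len_std
    by (intro hurwitz_transpositions[OF V _ _ std_arrows_on[OF m part] std_arrows_linked[OF m part]])
      (simp_all only: ys_def length_map)
  from hurwitz_eq_congruent[OF this]
  have "mat_congruent (length xs) (arrow_gram ys) (arrow_gram ?std)" by (simp add: ys_def)
  moreover have "arrow_gram ys = arrow_gram xs"
    unfolding ys_def by (rule arrow_gram_relabel[OF permutes_inj_on[OF \<sigma>] xs(1)])
  ultimately show ?thesis using part len_std by (intro exI[of _ \<pi>] exI[of _ d]) simp
qed

text \<open>The fixed point counts of all powers determine the parts; once these agree, the common
  number of arrows determines the genus.\<close>

lemma std_arrows_congruent_unique:
  assumes m: "m \<ge> 2" and part: "partition_of m \<pi>" "partition_of m \<pi>'"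
    and len: "length (std_arrows m \<pi> d) = n" "length (std_arrows m \<pi>' d') = n"
    and cong: "mat_congruent n (arrow_gram (std_arrows m \<pi> d)) (arrow_gram (std_arrows m \<pi>' d'))"
  shows "\<pi> = \<pi>' \<and> d = d'"
proof -
  have "(\<Sum>p\<leftarrow>\<pi>. if p dvd k then p else 0) = (\<Sum>p\<leftarrow>\<pi>'. if p dvd k then p else 0)" for k
    using card_fixed_congruent[OF std_arrows_on[OF m part(1)] std_arrows_on[OF m part(2)], of d d' k]
      cycle_type_card_fixed[OF std_arrows_cycle_type[OF m part(1)], of k d]
      cycle_type_card_fixed[OF std_arrows_cycle_type[OF m part(2)], of k d'] len cong
    by simp
  then have "(\<Sum>p\<leftarrow>rev \<pi>. if p dvd k then p else 0) = (\<Sum>p\<leftarrow>rev \<pi>'. if p dvd k then p else 0)" for k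
    by (simp add: rev_map[symmetric])
  then have "rev \<pi> = rev \<pi>'"
    using part by (intro sorted_divisor_sums_unique) (auto simp: partition_of_def sorted_wrt_rev)
  then have "\<pi> = \<pi>'" by simp
  with len show ?thesis by (simp add: std_arrows_def del: upt_Suc)
qed

theorem theoremA:
  fixes r n :: nat and q :: "int vec \<Rightarrow> int"
  assumes "r \<ge> 1"
    and "unit_form n q"
    and "nonneg_form n q"
    and "connected_form n q"
    and "has_dynkin_type n q (Dynkin_A r)"
  shows "\<exists>!(\<pi>, d). partition_of (r + 1) \<pi> \<and>
           num_arrows (std_quiver (r + 1) \<pi> d) = n \<and>
           strongly_gram_congruent n q (quiver_form (std_quiver (r + 1) \<pi> d))"
proof -
  let ?m = "r + 1"
  let ?P = "\<lambda>\<pi> d. partition_of ?m \<pi> \<and> num_arrows (std_quiver ?m \<pi> d) = n \<and>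
    strongly_gram_congruent n q (quiver_form (std_quiver ?m \<pi> d))"
  have m: "?m \<ge> 2" using assms(1) by simp
  obtain xs where xs: "length xs = n" "arrows_on {1..?m} xs" "linked {1..?m} xs"
    "\<forall>x \<in> carrier_vec n. 2 * q x = (\<Sum>v=1..?m. (\<Sum>i<n. x $ i * incidence (xs ! i) v)\<^sup>2)"
    using dynkin_A_arrows[OF assms(2,5)] .
  have q: "upper_gram n q = arrow_gram xs"
    by (rule upper_gram_arrows[OF _ xs(2,1) bspec[OF xs(4)]]) simp
  have num: "num_arrows (std_quiver ?m \<pi> d) = length (std_arrows ?m \<pi> d)" for \<pi> d
    by (simp add: std_quiver_def std_arrows_def del: upt_Suc)
  \<comment> \<open>From here on everything concerns matrices of arrow lists: both upper Gram
    matrices are known explicitly.\<close>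
  have P: "?P \<pi> d \<longleftrightarrow> partition_of ?m \<pi> \<and> length (std_arrows ?m \<pi> d) = n \<and>
      mat_congruent n (arrow_gram xs) (arrow_gram (std_arrows ?m \<pi> d))" for \<pi> d
  proof -
    have "upper_gram n (quiver_form (std_quiver ?m \<pi> d)) = arrow_gram (std_arrows ?m \<pi> d)"
      if "partition_of ?m \<pi>" "length (std_arrows ?m \<pi> d) = n"
      using upper_gram_std_quiver[OF m that(1), of d] that(2) unfolding num by simp
    then show ?thesis
      unfolding strongly_gram_congruent_def mat_congruent_def q num by (metis (no_types))
  qed
  obtain \<pi> d where \<pi>d: "?P \<pi> d"
    unfolding P using ex_congruent_std_arrows[OF m xs(2,3)] unfolding xs(1) by blast
  have unique: "\<pi>' = \<pi> \<and> d' = d" if "?P \<pi>' d'" for \<pi>' d'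
  proof -
    have carrier: "arrow_gram xs \<in> carrier_mat n n" "arrow_gram (std_arrows ?m \<pi>' d') \<in> carrier_mat n n"
      using that arrow_gram_carrier[of xs] arrow_gram_carrier[of "std_arrows ?m \<pi>' d'"] xs(1)
      unfolding P by simp_all
    have "mat_congruent n (arrow_gram (std_arrows ?m \<pi>' d')) (arrow_gram (std_arrows ?m \<pi> d))"
      using that \<pi>d mat_congruent_trans[OF carrier(2) mat_congruent_sym[OF carrier(1)]]
      unfolding P by blast
    then show ?thesis
      using std_arrows_congruent_unique[OF m] that \<pi>d unfolding P by blast
  qed
  show ?thesis
  proof (rule ex1I[of _ "(\<pi>, d)"])
    show "case (\<pi>, d) of (\<pi>, d) \<Rightarrow> ?P \<pi> d" unfolding prod.case by (rule \<pi>d)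
    fix x assume x: "case x of (\<pi>, d) \<Rightarrow> ?P \<pi> d"
    obtain \<pi>' d' where x': "x = (\<pi>', d')" by force
    with unique x show "x = (\<pi>, d)" unfolding x' prod.case by simp
  qed
qed

end
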